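(* Let $k$ be a field of characteristic zero, $R=k[x_1,\ldots,x_n]$, let $f_1,\ldots,f_m\in R$ be forms, and let $A=k[f_1,\ldots,f_m]\subset R$. With $\pi$, $\mathcal{D}(\mathbf f)$ and $\mathfrak{Z}$ as defined in the context, there is an $A$-module homomorphism $\lambda:\Omega_{A/k}\to\mathcal{D}(\mathbf f)$ such that $$\pi^{-1}(\ker(\lambda))=\pi^{-1}(\tau_A(\Omega_{A/k}))=\mathfrak{Z}^c,$$ where $\tau_A(\Omega_{A/k})$ denotes the $A$-torsion submodule of $\Omega_{A/k}$ and $\mathfrak{Z}^c=\mathfrak{Z}\cap\sum_{j=1}^m A\,dT_j$ denotes the contraction of $\mathfrak{Z}$ via the natural inclusion $\sum_{j=1}^m A\,dT_j\subset\sum_{j=1}^m R\,dT_j$ induced by $A\subset R$.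
   Context: Write $\mathbf f=f_1,\ldots,f_m$. $\Omega_{A/k}$ is the module of K\"ahler $k$-differentials of $A$. $\sum_{j=1}^m A\,dT_j$ and $\sum_{j=1}^m R\,dT_j$ denote the free modules over $A$ and over $R$ with basis $dT_1,\ldots,dT_m$. Let $P\subset k[T_1,\ldots,T_m]$ be the kernel of the $k$-algebra map $T_j\mapsto f_j$, so that $A\simeq k[T_1,\ldots,T_m]/P$. The map $\pi:\sum_{j=1}^m A\,dT_j\to\Omega_{A/k}$ is the natural surjection coming from this presentation (it sends $dT_j$ to the universal differential of $f_j$); it is the right-hand map of the conormal exact sequence $0\to P/P^{(2)}\to\sum_{j=1}^m A\,dT_j\to\Omega_{A/k}\to 0$, where $P^{(2)}$ is the second symbolic power of $P$. For $f\in R$ put $df=\sum_{i=1}^n\frac{\partial f}{\partial x_i}dx_i$ in the free $R$-module $\sum_{i=1}^n R\,dx_i$. The transposed Jacobian module $\mathcal{D}(\mathbf f)$ is the $R$-submodule $\sum_{j=1}^m R\,df_j\subset\sum_{i=1}^n R\,dx_i$, and $\mathfrak{Z}$ is the kernel of the surjective $R$-linear map $\sum_{j=1}^m R\,dT_j\to\mathcal{D}(\mathbf f)$, $dT_j\mapsto df_j$. *)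

theory Defs
  imports
    "HOL-Algebra.Algebra"
    "HOL-Algebra.Algebraic_Closure_Type"
    "HOL-Library.Poly_Mapping"
begin

section \<open>Modules over a commutative ring\<close>

text \<open>
  The \<open>mult\<close> and \<open>one\<close> fields of a \<open>module\<close> record carry no meaning for a module; they are
  filled with \<open>undefined\<close>.
\<close>

text \<open>
  The free module on a (possibly infinite) index set \<open>I\<close>: finitely supported families, extended by
  zero outside \<open>I\<close>. For a subring \<open>A\<close> of \<open>R\<close> the free \<open>A\<close>-module on \<open>I\<close> is thus literally
  contained in the free \<open>R\<close>-module on \<open>I\<close>.
\<close>

definition free_module :: "('a, 'm) ring_scheme \<Rightarrow> 'i set \<Rightarrow> ('a, 'i \<Rightarrow> 'a) module" where
  "free_module R I =
    \<lparr>carrier = {v. (\<forall>i\<in>I. v i \<in> carrier R) \<and> (\<forall>i. i \<notin> I \<longrightarrow> v i = \<zero>\<^bsub>R\<^esub>) \<and>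
                   finite {i. v i \<noteq> \<zero>\<^bsub>R\<^esub>}},
     monoid.mult = undefined, monoid.one = undefined,
     ring.zero = (\<lambda>i. \<zero>\<^bsub>R\<^esub>), ring.add = (\<lambda>u v i. u i \<oplus>\<^bsub>R\<^esub> v i),
     module.smult = (\<lambda>c v i. c \<otimes>\<^bsub>R\<^esub> v i)\<rparr>"

definition basis_vec :: "('a, 'm) ring_scheme \<Rightarrow> 'i \<Rightarrow> 'i \<Rightarrow> 'a" where
  "basis_vec R j = (\<lambda>i. if i = j then \<one>\<^bsub>R\<^esub> else \<zero>\<^bsub>R\<^esub>)"

definition submodule_span ::
    "('a, 'm) ring_scheme \<Rightarrow> ('a, 'b, 'n) module_scheme \<Rightarrow> 'b set \<Rightarrow> 'b set" where
  "submodule_span R M S = \<Inter>{N. submodule N R M \<and> S \<subseteq> N}"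

text \<open>The quotient of a module by a submodule, in the style of \<^const>\<open>FactRing\<close>.\<close>

definition quotient_module :: "('a, 'b, 'n) module_scheme \<Rightarrow> 'b set \<Rightarrow> ('a, 'b set) module" where
  "quotient_module M N =
    \<lparr>carrier = a_rcosets\<^bsub>M\<^esub> N, monoid.mult = undefined, monoid.one = undefined,
     ring.zero = N, ring.add = set_add M,
     module.smult = (\<lambda>c C. \<Union>x\<in>C. N +>\<^bsub>M\<^esub> (c \<odot>\<^bsub>M\<^esub> x))\<rparr>"

definition linear_maps ::
    "('a, 'm) ring_scheme \<Rightarrow> ('a, 'b, 'n) module_scheme \<Rightarrow> ('a, 'c, 'p) module_scheme \<Rightarrow> ('b \<Rightarrow> 'c) set"
  where
  "linear_maps R M N =
    {h \<in> hom (add_monoid M) (add_monoid N).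
       \<forall>c\<in>carrier R. \<forall>x\<in>carrier M. h (c \<odot>\<^bsub>M\<^esub> x) = c \<odot>\<^bsub>N\<^esub> h x}"

text \<open>The torsion submodule; meant for modules over an integral domain.\<close>

definition torsion :: "('a, 'm) ring_scheme \<Rightarrow> ('a, 'b, 'n) module_scheme \<Rightarrow> 'b set" where
  "torsion R M =
    {x \<in> carrier M. \<exists>c\<in>carrier R. c \<noteq> \<zero>\<^bsub>R\<^esub> \<and> c \<odot>\<^bsub>M\<^esub> x = \<zero>\<^bsub>M\<^esub>}"


section \<open>Kaehler differentials\<close>

text \<open>
  Let \<open>A\<close> be a commutative ring and \<open>K\<close> a subring of \<open>A\<close>. The module of Kaehler
  \<open>K\<close>-differentials is the free \<open>A\<close>-module on symbols \<open>d a\<close> (\<open>a \<in> A\<close>) modulo the submodule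
  generated by \<open>d (a + b) - d a - d b\<close>, \<open>d (a b) - a d b - b d a\<close> and \<open>d c\<close> for \<open>c \<in> K\<close>.
\<close>

definition kaehler_relations :: "'a set \<Rightarrow> ('a, 'm) ring_scheme \<Rightarrow> ('a \<Rightarrow> 'a) set" where
  "kaehler_relations K A =
    (let F = free_module A (carrier A); e = basis_vec A in
      {e (a \<oplus>\<^bsub>A\<^esub> b) \<ominus>\<^bsub>F\<^esub> (e a \<oplus>\<^bsub>F\<^esub> e b) | a b. a \<in> carrier A \<and> b \<in> carrier A} \<union>
      {e (a \<otimes>\<^bsub>A\<^esub> b) \<ominus>\<^bsub>F\<^esub> (a \<odot>\<^bsub>F\<^esub> e b \<oplus>\<^bsub>F\<^esub> b \<odot>\<^bsub>F\<^esub> e a) | a b. a \<in> carrier A \<and> b \<in> carrier A} \<union>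
      e ` K)"

definition kaehler_kernel :: "'a set \<Rightarrow> ('a, 'm) ring_scheme \<Rightarrow> ('a \<Rightarrow> 'a) set" where
  "kaehler_kernel K A = submodule_span A (free_module A (carrier A)) (kaehler_relations K A)"

definition kaehler :: "'a set \<Rightarrow> ('a, 'm) ring_scheme \<Rightarrow> ('a, ('a \<Rightarrow> 'a) set) module" where
  "kaehler K A = quotient_module (free_module A (carrier A)) (kaehler_kernel K A)"

definition kaehler_d :: "'a set \<Rightarrow> ('a, 'm) ring_scheme \<Rightarrow> 'a \<Rightarrow> ('a \<Rightarrow> 'a) set" where
  "kaehler_d K A a = kaehler_kernel K A +>\<^bsub>free_module A (carrier A)\<^esub> basis_vec A a"


section \<open>Multivariate polynomials\<close>

text \<open>
  Polynomials in variables indexed by the natural numbers, as finitely supported functions from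
  exponent vectors to coefficients. The ring \<open>k[x\<^sub>1, \<dots>, x\<^sub>n]\<close> consists of those involving only
  the variables with index \<open>< n\<close>, so \<open>x\<^sub>i\<close> has index \<open>i - 1\<close>; likewise \<open>f\<^sub>1, \<dots>, f\<^sub>m\<close> are indexed
  by \<open>{..<m}\<close>.
\<close>

type_synonym 'k mpol = "(nat \<Rightarrow>\<^sub>0 nat) \<Rightarrow>\<^sub>0 'k"

definition mpol_ring :: "nat \<Rightarrow> 'k::field mpol ring" where
  "mpol_ring n = ring_of_type_algebra\<lparr>carrier := {p. \<forall>t\<in>Poly_Mapping.keys p. Poly_Mapping.keys t \<subseteq> {..<n}}\<rparr>"

definition constants :: "'k::field mpol set" where
  "constants = range (Poly_Mapping.single 0)"

definition monom_degree :: "(nat \<Rightarrow>\<^sub>0 nat) \<Rightarrow> nat" where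
  "monom_degree t = (\<Sum>i\<in>Poly_Mapping.keys t. Poly_Mapping.lookup t i)"

text \<open>A form is a homogeneous polynomial; the zero polynomial and constants count as forms.\<close>

definition is_form :: "'k::field mpol \<Rightarrow> bool" where
  "is_form p \<longleftrightarrow> (\<exists>d. \<forall>t\<in>Poly_Mapping.keys p. monom_degree t = d)"

definition partial_deriv :: "nat \<Rightarrow> 'k::field mpol \<Rightarrow> 'k mpol" where
  "partial_deriv i p =
    (\<Sum>t\<in>Poly_Mapping.keys p.
       Poly_Mapping.single (t - Poly_Mapping.single i 1)
         (of_nat (Poly_Mapping.lookup t i) * Poly_Mapping.lookup p t))"

text \<open>The differential \<open>d p\<close> as an element of the free module on \<open>dx\<^sub>1, \<dots>, dx\<^sub>n\<close>.\<close>

definition poly_diff :: "nat \<Rightarrow> 'k::field mpol \<Rightarrow> nat \<Rightarrow> 'k mpol" where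
  "poly_diff n p = (\<lambda>i. if i < n then partial_deriv i p else 0)"


section \<open>The objects attached to a sequence of forms\<close>

definition forms_algebra :: "nat \<Rightarrow> nat \<Rightarrow> (nat \<Rightarrow> 'k::field mpol) \<Rightarrow> 'k mpol ring" where
  "forms_algebra n m f =
    (mpol_ring n)\<lparr>carrier := generate_ring (mpol_ring n) (constants \<union> f ` {..<m})\<rparr>"

definition forms_kaehler ::
    "nat \<Rightarrow> nat \<Rightarrow> (nat \<Rightarrow> 'k::field mpol) \<Rightarrow> ('k mpol, ('k mpol \<Rightarrow> 'k mpol) set) module" where
  "forms_kaehler n m f = kaehler constants (forms_algebra n m f)"

text \<open>The \<open>A\<close>-linear map \<open>\<pi>\<close> sending \<open>dT\<^sub>j\<close> to the universal differential of \<open>f\<^sub>j\<close>.\<close>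

definition forms_pi ::
    "nat \<Rightarrow> nat \<Rightarrow> (nat \<Rightarrow> 'k::field mpol) \<Rightarrow> (nat \<Rightarrow> 'k mpol) \<Rightarrow> ('k mpol \<Rightarrow> 'k mpol) set" where
  "forms_pi n m f v =
    (\<Oplus>\<^bsub>forms_kaehler n m f\<^esub>j\<in>{..<m}.
       v j \<odot>\<^bsub>forms_kaehler n m f\<^esub> kaehler_d constants (forms_algebra n m f) (f j))"

definition pi_preimage ::
    "nat \<Rightarrow> nat \<Rightarrow> (nat \<Rightarrow> 'k::field mpol) \<Rightarrow> ('k mpol \<Rightarrow> 'k mpol) set set \<Rightarrow> (nat \<Rightarrow> 'k mpol) set" where
  "pi_preimage n m f S =
    {v \<in> carrier (free_module (forms_algebra n m f) {..<m}). forms_pi n m f v \<in> S}"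

text \<open>
  The transposed Jacobian module. Its scalar multiplication is that of \<open>R\<close>, so the same record is
  also the \<open>A\<close>-module obtained by restriction of scalars.
\<close>

definition jacobian_module ::
    "nat \<Rightarrow> nat \<Rightarrow> (nat \<Rightarrow> 'k::field mpol) \<Rightarrow> ('k mpol, nat \<Rightarrow> 'k mpol) module" where
  "jacobian_module n m f =
    (let F = free_module (mpol_ring n) {..<n} in
      F\<lparr>carrier := submodule_span (mpol_ring n) F ((\<lambda>j. poly_diff n (f j)) ` {..<m})\<rparr>)"

definition jacobian_map ::
    "nat \<Rightarrow> nat \<Rightarrow> (nat \<Rightarrow> 'k::field mpol) \<Rightarrow> (nat \<Rightarrow> 'k mpol) \<Rightarrow> nat \<Rightarrow> 'k mpol" where
  "jacobian_map n m f v =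
    (\<Oplus>\<^bsub>jacobian_module n m f\<^esub>j\<in>{..<m}. v j \<odot>\<^bsub>jacobian_module n m f\<^esub> poly_diff n (f j))"

definition jacobian_syz :: "nat \<Rightarrow> nat \<Rightarrow> (nat \<Rightarrow> 'k::field mpol) \<Rightarrow> (nat \<Rightarrow> 'k mpol) set" where
  "jacobian_syz n m f =
    a_kernel (free_module (mpol_ring n) {..<m}) (jacobian_module n m f) (jacobian_map n m f)"

end

theory Submission
  imports Defs
begin

text \<open>
  The map \<open>\<lambda>\<close> is induced by the derivation \<open>a \<mapsto> da\<close> of \<open>A\<close> into the transposed Jacobian module
  (\<open>kaehler_to_jacobian_exists\<close>). It satisfies \<open>\<lambda> (\<pi> v) = (\<Sum>j. v\<^sub>j df\<^sub>j)\<close>, so the preimage of its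
  kernel is the contraction of the syzygy module by construction. What has to be proved is that
  \<open>\<pi> v\<close> is torsion exactly when \<open>(\<Sum>j. v\<^sub>j df\<^sub>j) = 0\<close> (\<open>forms_pi_torsion_iff\<close>). One direction holds
  because the Jacobian module sits in a free module over a domain and has no torsion.

  For the other direction let \<open>\<omega> = \<pi> v\<close> be a non-torsion element. The module of differentials is
  generated by the \<open>df\<^sub>j\<close>, so linear algebra (\<open>separating_functional\<close>) yields an \<open>A\<close>-linear
  functional on it that does not vanish at \<open>\<omega>\<close>; composed with the universal derivation it is a
  derivation \<open>D\<close> of \<open>A\<close> with \<open>(\<Sum>j. v\<^sub>j D f\<^sub>j) \<noteq> 0\<close> (\<open>nontorsion_derivation\<close>). In characteristic
  zero derivations extend along arbitrary extensions of domains; adjoining the variables one at a time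
  extends \<open>D\<close> to a ring that contains them (\<open>extend_derivation_finite\<close>). There the chain rule
  \<open>D f\<^sub>j = (\<Sum>i. \<partial>f\<^sub>j/\<partial>x\<^sub>i D x\<^sub>i)\<close> gives \<open>(\<Sum>j. v\<^sub>j D f\<^sub>j) = (\<Sum>i. (\<Sum>j. v\<^sub>j \<partial>f\<^sub>j/\<partial>x\<^sub>i) D x\<^sub>i)\<close>,
  so the Jacobian expression \<open>(\<Sum>j. v\<^sub>j df\<^sub>j)\<close> cannot vanish.

  Functionals and derivations naturally take values in a fraction field. Here all of them take
  values in the domain itself: each construction is multiplied by a nonzero factor that clears the
  denominators, which is harmless because only the vanishing of values matters.
\<close>

section \<open>Subrings of an integral domain and their derivations\<close>

text \<open>
  Subrings of a type are handled as sets closed under the type class operations, so that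
  calculations in them are calculations in the type.
\<close>

locale subring_set =
  fixes S :: "'r::idom set"
  assumes one_closed: "1 \<in> S"
    and add_closed: "a \<in> S \<Longrightarrow> b \<in> S \<Longrightarrow> a + b \<in> S"
    and mult_closed: "a \<in> S \<Longrightarrow> b \<in> S \<Longrightarrow> a * b \<in> S"
    and uminus_closed: "a \<in> S \<Longrightarrow> - a \<in> S"
begin

lemma zero_closed: "0 \<in> S"
  using add_closed[OF one_closed uminus_closed[OF one_closed]] by simp

lemma diff_closed: "a \<in> S \<Longrightarrow> b \<in> S \<Longrightarrow> a - b \<in> S"
  using add_closed uminus_closed by fastforce

lemma sum_closed: "(\<And>i. i \<in> I \<Longrightarrow> g i \<in> S) \<Longrightarrow> sum g I \<in> S"
  by (induction I rule: infinite_finite_induct) (auto simp: zero_closed add_closed)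

lemma of_nat_closed: "of_nat k \<in> S"
  by (induction k) (auto simp: zero_closed one_closed add_closed)

lemmas closed = one_closed add_closed mult_closed uminus_closed zero_closed diff_closed
  of_nat_closed

end

text \<open>
  The derivation takes values in the whole domain, and its values outside \<open>S\<close> are arbitrary.
\<close>

definition derivation_on :: "'r::idom set \<Rightarrow> ('r \<Rightarrow> 'r) \<Rightarrow> bool" where
  "derivation_on S D \<longleftrightarrow>
    (\<forall>a\<in>S. \<forall>b\<in>S. D (a + b) = D a + D b \<and> D (a * b) = a * D b + b * D a)"

lemma derivation_onD:
  assumes "derivation_on S D" "a \<in> S" "b \<in> S"
  shows "D (a + b) = D a + D b" "D (a * b) = a * D b + b * D a"
  using assms by (auto simp: derivation_on_def)

lemma (in subring_set) derivation_on_zero: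
  assumes "derivation_on S D" shows "D 0 = 0"
  using derivation_onD(2)[OF assms zero_closed zero_closed] by simp

lemma (in subring_set) derivation_on_sum:
  assumes D: "derivation_on S D" and "\<And>i. i \<in> I \<Longrightarrow> g i \<in> S"
  shows "D (sum g I) = (\<Sum>i\<in>I. D (g i))"
  using assms(2)
  by (induction I rule: infinite_finite_induct)
    (auto simp: derivation_on_zero[OF D] derivation_onD[OF D] sum_closed)

lemma (in subring_set) derivation_on_diff:
  assumes D: "derivation_on S D" and a: "a \<in> S" "b \<in> S"
  shows "D (a - b) = D a - D b"
  using derivation_onD(1)[OF D diff_closed[OF a] a(2)] by simp

section \<open>Extending derivations in characteristic zero\<close>

context subring_set
begin

definition polys :: "'r poly set" where
  "polys = {p. \<forall>i. coeff p i \<in> S}"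

lemma polys_closed:
  "p \<in> polys \<Longrightarrow> q \<in> polys \<Longrightarrow> p + q \<in> polys"
  "p \<in> polys \<Longrightarrow> q \<in> polys \<Longrightarrow> p - q \<in> polys"
  "p \<in> polys \<Longrightarrow> - p \<in> polys"
  "p \<in> polys \<Longrightarrow> q \<in> polys \<Longrightarrow> p * q \<in> polys"
  "p \<in> polys \<Longrightarrow> pderiv p \<in> polys"
  "a \<in> S \<Longrightarrow> monom a i \<in> polys"
  "a \<in> S \<Longrightarrow> [:a:] \<in> polys"
  by (auto simp: polys_def coeff_mult coeff_pderiv coeff_pCons closed
      intro!: sum_closed mult_closed of_nat_closed split: nat.splits
      simp del: of_nat_Suc)

lemma coeff_map_derivation:
  assumes "derivation_on S D" shows "coeff (map_poly D p) i = D (coeff p i)"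
  using assms by (simp add: coeff_map_poly derivation_on_zero)

lemma map_derivation_add:
  assumes D: "derivation_on S D" and p: "p \<in> polys" "q \<in> polys"
  shows "map_poly D (p + q) = map_poly D p + map_poly D q"
  using p by (intro poly_eqI) (auto simp: coeff_map_derivation[OF D] polys_def derivation_onD[OF D])

lemma map_derivation_mult:
  assumes D: "derivation_on S D" and p: "p \<in> polys" "q \<in> polys"
  shows "map_poly D (p * q) = p * map_poly D q + q * map_poly D p"
proof (rule poly_eqI)
  fix n
  have c: "coeff p i \<in> S" "coeff q i \<in> S" for i
    using p by (auto simp: polys_def)
  have "coeff (map_poly D (p * q)) n = (\<Sum>i\<le>n. D (coeff p i * coeff q (n - i)))"
    using c by (simp add: coeff_map_derivation[OF D] coeff_mult derivation_on_sum[OF D] mult_closed)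
  also have "\<dots> = (\<Sum>i\<le>n. coeff p i * D (coeff q (n - i))) + (\<Sum>i\<le>n. coeff q (n - i) * D (coeff p i))"
    using c by (simp add: derivation_onD[OF D] sum.distrib)
  also have "(\<Sum>i\<le>n. coeff q (n - i) * D (coeff p i)) = (\<Sum>i\<le>n. coeff q i * D (coeff p (n - i)))"
    by (rule sum.reindex_bij_witness[of _ "\<lambda>i. n - i" "\<lambda>i. n - i"]) auto
  finally show "coeff (map_poly D (p * q)) n = coeff (p * map_poly D q + q * map_poly D p) n"
    by (simp add: coeff_mult coeff_map_derivation[OF D])
qed

text \<open>
  The only possible value at \<open>p(x)\<close> of a derivation that agrees with \<open>c D\<close> on the coefficients and
  sends \<open>x\<close> to \<open>u\<close>. It obeys the Leibniz rule along evaluation at \<open>x\<close>, so it defines a derivation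
  on the polynomial expressions in \<open>x\<close> as soon as it vanishes on all relations that \<open>x\<close> satisfies.
\<close>

definition derivation_lift :: "('r \<Rightarrow> 'r) \<Rightarrow> 'r \<Rightarrow> 'r \<Rightarrow> 'r \<Rightarrow> 'r poly \<Rightarrow> 'r" where
  "derivation_lift D x c u p = c * poly (map_poly D p) x + u * poly (pderiv p) x"

lemma derivation_lift_add:
  assumes "derivation_on S D" "p \<in> polys" "q \<in> polys"
  shows "derivation_lift D x c u (p + q) = derivation_lift D x c u p + derivation_lift D x c u q"
  using assms by (simp add: derivation_lift_def map_derivation_add pderiv_add algebra_simps)

lemma derivation_lift_diff:
  assumes "derivation_on S D" "p \<in> polys" "q \<in> polys"
  shows "derivation_lift D x c u (p - q) = derivation_lift D x c u p - derivation_lift D x c u q"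
  using derivation_lift_add[OF assms(1) polys_closed(2)[OF assms(2,3)] assms(3)] by simp

lemma derivation_lift_mult:
  assumes "derivation_on S D" "p \<in> polys" "q \<in> polys"
  shows "derivation_lift D x c u (p * q)
    = poly p x * derivation_lift D x c u q + poly q x * derivation_lift D x c u p"
  using assms by (simp add: derivation_lift_def map_derivation_mult pderiv_mult algebra_simps)

end

text \<open>
  It suffices that the lift vanishes at one relation \<open>p\<close> of minimal degree. For any other relation
  \<open>q\<close>, subtracting a multiple of \<open>p\<close> from \<open>lead_coeff p * q\<close> cancels the leading term and leaves a
  relation of smaller degree; at relations of \<open>x\<close> the lift is compatible with these operations, and
  \<open>lead_coeff p\<close> can be cancelled.
\<close>

lemma (in subring_set) derivation_lift_vanishes:
  assumes D: "derivation_on S D"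
    and p: "p \<in> polys" "poly p x = 0"
    and p0: "derivation_lift D x c u p = 0"
    and pn: "lead_coeff p \<noteq> 0"
    and min: "\<And>q. q \<in> polys \<Longrightarrow> poly q x = 0 \<Longrightarrow> q \<noteq> 0 \<Longrightarrow> degree p \<le> degree q"
    and q: "q \<in> polys" "poly q x = 0"
  shows "derivation_lift D x c u q = 0"
  using q
proof (induction "degree q" arbitrary: q rule: less_induct)
  case less
  note L = derivation_lift_mult[OF D] derivation_lift_diff[OF D]
  show ?case
  proof (cases "degree q < degree p \<or> degree q = 0")
    case True
    show ?thesis
    proof (cases "q = 0")
      case True
      then show ?thesis by (simp add: derivation_lift_def)
    next
      case False
      then have "degree p \<le> degree q"
        using min less.prems by blast
      with True have "degree q = 0"  by auto
      then obtain a where "q = [:a:]" using degree_eq_zeroE by blast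
      with less.prems False show ?thesis by simp
    qed
  next
    case False
    define a where "a = lead_coeff p"
    define m where "m = monom (lead_coeff q) (degree q - degree p)"
    have S: "a \<in> S" "lead_coeff q \<in> S"
      using p less.prems by (auto simp: polys_def a_def)
    have mp: "m \<in> polys" "[:a:] \<in> polys"
      using S by (auto simp: m_def polys_closed)
    define r where "r = [:a:] * q - m * p"
    have r: "r \<in> polys" "poly r x = 0"
      using less.prems p mp unfolding r_def by (auto intro!: polys_closed(2,4) simp del: mult_pCons_left)
    have "coeff r i = 0" if "i \<ge> degree q" for i
    proof (cases "i = degree q")
      case True
      then show ?thesis
        using False by (simp add: r_def m_def coeff_monom_mult a_def mult.commute[of "lead_coeff p" "lead_coeff q"])
    next
      case F: False
      then have "coeff q i = 0" "coeff p (i - (degree q - degree p)) = 0"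
        using that False by (auto intro!: coeff_eq_0)
      then show ?thesis
        by (simp add: r_def m_def coeff_monom_mult)
    qed
    then have "degree r < degree q"
      using False by (intro degree_lessI) auto
    then have "derivation_lift D x c u r = 0"
      using less.hyps r by blast
    moreover have "derivation_lift D x c u r = a * derivation_lift D x c u q"
      using less.prems p p0 mp unfolding r_def by (simp add: L polys_closed del: mult_pCons_left)
    ultimately have "a * derivation_lift D x c u q = 0" by simp
    then show ?thesis using pn unfolding a_def by simp
  qed
qed

text \<open>
  If \<open>x\<close> is transcendental over \<open>S\<close>, sending \<open>x\<close> to \<open>0\<close> works. If \<open>p\<close> is a relation of minimal
  degree, characteristic zero gives \<open>p'(x) \<noteq> 0\<close>; over the fraction field \<open>x\<close> has to go to
  \<open>- p\<^sup>D(x) / p'(x)\<close>, where \<open>p\<^sup>D\<close> has the coefficients of \<open>p\<close> differentiated, and the factor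
  \<open>c = p'(x)\<close> clears the denominator.
\<close>

lemma extend_derivation:
  fixes S :: "'r::{idom,ring_char_0} set"
  assumes S: "subring_set S" and D: "derivation_on S D"
  shows "\<exists>S' c D'. subring_set S' \<and> S \<subseteq> S' \<and> x \<in> S' \<and> c \<noteq> 0 \<and> derivation_on S' D' \<and>
    (\<forall>a\<in>S. D' a = c * D a)"
proof -
  interpret subring_set S by (rule S)
  have "\<exists>c u. c \<noteq> 0 \<and> (\<forall>q\<in>polys. poly q x = 0 \<longrightarrow> derivation_lift D x c u q = 0)"
  proof (cases "\<exists>p\<in>polys. p \<noteq> 0 \<and> poly p x = 0")
    case False
    then show ?thesis
      by (intro exI[of _ 1] exI[of _ 0]) (auto simp: derivation_lift_def)
  next
    case True
    then obtain p0 where "p0 \<in> polys \<and> p0 \<noteq> 0 \<and> poly p0 x = 0" by blast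
    from ex_has_least_nat[of "\<lambda>p. p \<in> polys \<and> p \<noteq> 0 \<and> poly p x = 0", OF this, of degree]
    obtain p where p: "p \<in> polys" "p \<noteq> 0" "poly p x = 0"
      and min: "\<And>q. q \<in> polys \<Longrightarrow> poly q x = 0 \<Longrightarrow> q \<noteq> 0 \<Longrightarrow> degree p \<le> degree q"
      by blast
    define c where "c = poly (pderiv p) x"
    define u where "u = - poly (map_poly D p) x"
    have "degree p \<noteq> 0"
    proof
      assume "degree p = 0"
      then obtain a where "p = [:a:]" using degree_eq_zeroE by blast
      with p show False by simp
    qed
    then have "pderiv p \<noteq> 0" "degree (pderiv p) < degree p"
      by (auto simp: pderiv_eq_0_iff degree_pderiv)
    then have "c \<noteq> 0"
      using min[OF polys_closed(5)[OF p(1)]] by (auto simp: c_def)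
    have "derivation_lift D x c u p = 0"
      by (simp add: derivation_lift_def c_def u_def)
    then have "\<forall>q\<in>polys. poly q x = 0 \<longrightarrow> derivation_lift D x c u q = 0"
      using p(2) min by (auto intro!: derivation_lift_vanishes[OF D p(1,3)])
    with \<open>c \<noteq> 0\<close> show ?thesis by blast
  qed
  then obtain c u where c: "c \<noteq> 0"
    and wd: "\<And>q. q \<in> polys \<Longrightarrow> poly q x = 0 \<Longrightarrow> derivation_lift D x c u q = 0"
    by blast
  define E where "E = derivation_lift D x c u"
  define S' where "S' = (\<lambda>p. poly p x) ` polys"
  define D' where "D' y = E (SOME p. p \<in> polys \<and> poly p x = y)" for y
  have D': "D' (poly p x) = E p" if "p \<in> polys" for p
  proof -
    let ?q = "SOME q. q \<in> polys \<and> poly q x = poly p x"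
    have q: "?q \<in> polys \<and> poly ?q x = poly p x"
      by (rule someI[of _ p]) (simp add: that)
    then have "E (?q - p) = 0"
      using that wd[of "?q - p"] by (simp add: E_def polys_closed)
    then show ?thesis
      using q that by (simp add: D'_def E_def derivation_lift_diff[OF D])
  qed
  have const: "a \<in> S \<Longrightarrow> a = poly [:a:] x" for a by simp
  have "subring_set S'"
  proof
    show "1 \<in> S'"
      unfolding S'_def using polys_closed(7)[OF one_closed] by (rule image_eqI[rotated]) simp
    fix a b assume "a \<in> S'" "b \<in> S'"
    then obtain p q where pq: "p \<in> polys" "q \<in> polys" "a = poly p x" "b = poly q x"
      by (auto simp: S'_def)
    show "a + b \<in> S'"
      using pq unfolding S'_def by (auto intro!: image_eqI[of _ _ "p + q"] polys_closed)
    show "a * b \<in> S'"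
      using pq unfolding S'_def by (auto intro!: image_eqI[of _ _ "p * q"] polys_closed)
    show "- a \<in> S'"
      using pq unfolding S'_def by (auto intro!: image_eqI[of _ _ "- p"] polys_closed)
  qed
  moreover have "S \<subseteq> S'"
    unfolding S'_def using polys_closed(7) const by blast
  moreover have "x \<in> S'"
    unfolding S'_def using polys_closed(6)[OF one_closed, of 1]
    by (rule image_eqI[rotated]) (simp add: poly_monom)
  moreover have "derivation_on S' D'"
    unfolding derivation_on_def
  proof (intro ballI)
    fix a b assume "a \<in> S'" "b \<in> S'"
    then obtain p q where pq: "p \<in> polys" "q \<in> polys" "a = poly p x" "b = poly q x"
      by (auto simp: S'_def)
    show "D' (a + b) = D' a + D' b \<and> D' (a * b) = a * D' b + b * D' a"
      using D'[OF pq(1)] D'[OF pq(2)] D'[OF polys_closed(1)[OF pq(1,2)]]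
        D'[OF polys_closed(4)[OF pq(1,2)]] pq(3,4)
      by (simp add: E_def derivation_lift_add[OF D pq(1,2)] derivation_lift_mult[OF D pq(1,2)])
  qed
  moreover have "D' a = c * D a" if "a \<in> S" for a
    using D'[OF polys_closed(7)[OF that]] derivation_on_zero[OF D]
    by (simp add: E_def derivation_lift_def map_poly_pCons pderiv_pCons)
  ultimately show ?thesis using c by blast
qed

lemma extend_derivation_finite:
  fixes S :: "'r::{idom,ring_char_0} set"
  assumes S: "subring_set S" and D: "derivation_on S D" and Y: "finite Y"
  shows "\<exists>S' c D'. subring_set S' \<and> S \<subseteq> S' \<and> Y \<subseteq> S' \<and> c \<noteq> 0 \<and> derivation_on S' D' \<and>
    (\<forall>a\<in>S. D' a = c * D a)"
  using Y
proof induction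
  case empty
  then show ?case using S D by (intro exI[of _ S] exI[of _ 1] exI[of _ D]) auto
next
  case (insert x Y)
  then obtain S1 c1 D1 where 1: "subring_set S1" "S \<subseteq> S1" "Y \<subseteq> S1" "c1 \<noteq> 0" "derivation_on S1 D1"
    "\<And>a. a \<in> S \<Longrightarrow> D1 a = c1 * D a" by metis
  obtain S2 c2 D2 where 2: "subring_set S2" "S1 \<subseteq> S2" "x \<in> S2" "c2 \<noteq> 0" "derivation_on S2 D2"
    "\<And>a. a \<in> S1 \<Longrightarrow> D2 a = c2 * D1 a" using extend_derivation[OF 1(1,5)] by metis
  show ?case
    using 1 2 by (intro exI[of _ S2] exI[of _ "c2 * c1"] exI[of _ D2]) auto
qed

section \<open>Separating functionals\<close>

text \<open>
  Over the fraction field this says that a vector outside a subspace is separated from it by a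
  functional. A functional with value \<open>c \<noteq> 0\<close> at \<open>v\<close> and \<open>0\<close> on \<open>W\<close> is built coordinate by coordinate:
  at stage \<open>r\<close> its values \<open>u\<close> at the first \<open>r\<close> unit vectors respect all relations
  \<open>w \<equiv> a v\<close> modulo \<open>W\<close> with \<open>w\<close> supported on the first \<open>r\<close> coordinates. A relation with
  \<open>w\<^sub>r \<noteq> 0\<close> forces the next value up to the denominator \<open>w\<^sub>r\<close>, by which everything is rescaled; any
  other relation reduces to the previous stage by elimination of its last coordinate.
\<close>

lemma separating_functional:
  fixes S :: "'r::idom set" and W :: "(nat \<Rightarrow> 'r) set"
  assumes S: "subring_set S"
    and W_S: "\<And>w j. w \<in> W \<Longrightarrow> w j \<in> S"
    and W_diff: "\<And>w w'. w \<in> W \<Longrightarrow> w' \<in> W \<Longrightarrow> (\<lambda>j. w j - w' j) \<in> W"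
    and W_smult: "\<And>a w. a \<in> S \<Longrightarrow> w \<in> W \<Longrightarrow> (\<lambda>j. a * w j) \<in> W"
    and W_supp: "\<And>w j. w \<in> W \<Longrightarrow> j \<ge> m \<Longrightarrow> w j = 0"
    and v: "\<And>j. v j \<in> S" "\<And>j. j \<ge> m \<Longrightarrow> v j = 0"
    and W0: "(\<lambda>j. 0) \<in> W"
    and sat: "\<And>a. a \<in> S \<Longrightarrow> a \<noteq> 0 \<Longrightarrow> (\<lambda>j. a * v j) \<notin> W"
  shows "\<exists>u. (\<forall>w\<in>W. (\<Sum>j<m. w j * u j) = 0) \<and> (\<Sum>j<m. v j * u j) \<noteq> 0"
proof -
  interpret subring_set S by (rule S)
  \<comment> \<open>\<open>N r\<close> consists of the relations \<open>w \<equiv> a v\<close> modulo \<open>W\<close> that involve the first \<open>r\<close> coordinates only.\<close>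
  define N where "N r = {(w, a). a \<in> S \<and> (\<forall>j. w j \<in> S) \<and> (\<forall>j\<ge>r. w j = 0) \<and> (\<lambda>j. w j - a * v j) \<in> W}"
    for r :: nat
  have "\<exists>u c. c \<noteq> 0 \<and> (\<forall>(w, a)\<in>N r. (\<Sum>j<r. w j * u j) = c * a)" for r
  proof (induction r)
    case 0
    have "a = 0" if "(w, a) \<in> N 0" for w a
    proof (rule ccontr)
      assume "a \<noteq> 0"
      moreover have "(\<lambda>j. a * v j) \<in> W"
        using W_diff[OF W0, of "\<lambda>j. w j - a * v j"] that by (auto simp: N_def)
      ultimately show False using sat that by (auto simp: N_def)
    qed
    then show ?case by (intro exI[of _ "\<lambda>_. 0"] exI[of _ 1]) auto
  next
    case (Suc r)
    then obtain u c where c: "c \<noteq> 0"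
      and u: "\<And>w a. (w, a) \<in> N r \<Longrightarrow> (\<Sum>j<r. w j * u j) = c * a" by blast
    show ?case
    proof (cases "\<exists>(w, a)\<in>N (Suc r). w r \<noteq> 0")
      case False
      have "(\<Sum>j<Suc r. w j * u j) = c * a" if wa: "(w, a) \<in> N (Suc r)" for w a
      proof -
        have wr: "w r = 0" using False wa by auto
        have "w j = 0" if "j \<ge> r" for j
          using wr wa that by (cases "j = r") (simp_all add: N_def)
        then have "(w, a) \<in> N r"
          using wa by (simp add: N_def)
        then show ?thesis using u wr by simp
      qed
      with c show ?thesis by blast
    next
      case True
      then obtain w a where wa: "(w, a) \<in> N (Suc r)" and b: "w r \<noteq> 0" by blast
      define u' where "u' j = (if j < r then w r * u j else c * a - (\<Sum>i<r. w i * u i))" for j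
      have "(\<Sum>j<Suc r. w' j * u' j) = (c * w r) * a'" if wa': "(w', a') \<in> N (Suc r)" for w' a'
      proof -
        \<comment> \<open>This combination of the two relations has no coordinate \<open>r\<close> left.\<close>
        define w'' where "w'' j = w r * w' j - w' r * w j" for j
        have "(\<lambda>j. w r * (w' j - a' * v j) - w' r * (w j - a * v j)) \<in> W"
          by (rule W_diff[OF W_smult W_smult]) (use wa wa' in \<open>auto simp: N_def\<close>)
        also have "(\<lambda>j. w r * (w' j - a' * v j) - w' r * (w j - a * v j))
            = (\<lambda>j. w'' j - (w r * a' - w' r * a) * v j)"
          by (auto simp: w''_def algebra_simps)
        finally have "(\<lambda>j. w'' j - (w r * a' - w' r * a) * v j) \<in> W" .
        moreover have "w'' j = 0" if "j \<ge> r" for j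
        proof (cases "j = r")
          case False
          then have "w j = 0 \<and> w' j = 0"
            using that wa wa' by (simp add: N_def)
          then show ?thesis by (simp add: w''_def)
        qed (simp add: w''_def)
        moreover have "w'' j \<in> S" for j
          using wa wa' unfolding w''_def by (intro diff_closed mult_closed) (auto simp: N_def)
        moreover have "w r * a' - w' r * a \<in> S"
          using wa wa' by (intro diff_closed mult_closed) (auto simp: N_def)
        ultimately have "(w'', w r * a' - w' r * a) \<in> N r"
          by (simp add: N_def)
        from u[OF this] have "w r * (\<Sum>j<r. w' j * u j) - w' r * (\<Sum>j<r. w j * u j)
            = c * (w r * a' - w' r * a)"
          by (simp add: w''_def left_diff_distrib sum_subtractf sum_distrib_left mult.assoc)
        moreover have "(\<Sum>j<Suc r. w' j * u' j)
            = w r * (\<Sum>j<r. w' j * u j) + w' r * (c * a - (\<Sum>i<r. w i * u i))"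
          by (simp add: u'_def sum_distrib_left algebra_simps)
        ultimately show ?thesis by (simp add: algebra_simps)
      qed
      with c b show ?thesis by (intro exI[of _ u'] exI[of _ "c * w r"]) auto
    qed
  qed
  then obtain u c where c: "c \<noteq> 0"
    and u: "\<And>w a. (w, a) \<in> N m \<Longrightarrow> (\<Sum>j<m. w j * u j) = c * a" by blast
  \<comment> \<open>The relations \<open>w \<equiv> 0 v\<close> for \<open>w \<in> W\<close> and \<open>v \<equiv> 1 v\<close> give the two claims.\<close>
  have "(\<Sum>j<m. w j * u j) = 0" if "w \<in> W" for w
    using u[of w 0] that W_S W_supp zero_closed by (auto simp: N_def)
  moreover have "(\<Sum>j<m. v j * u j) = c"
    using u[of v 1] v W0 one_closed by (auto simp: N_def)
  ultimately show ?thesis using c by auto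
qed

section \<open>Partial derivatives of polynomials\<close>

lemma subring_set_UNIV: "subring_set UNIV"
  by unfold_locales auto

definition mvar :: "nat \<Rightarrow> 'k::field mpol" where
  "mvar i = Poly_Mapping.single (Poly_Mapping.single i 1) 1"

definition mpol_set :: "nat \<Rightarrow> 'k::field mpol set" where
  "mpol_set n = {p. \<forall>t\<in>Poly_Mapping.keys p. Poly_Mapping.keys t \<subseteq> {..<n}}"

lemma mpol_sum_monomials:
  fixes p :: "'k::field mpol"
  shows "p = (\<Sum>t\<in>Poly_Mapping.keys p. Poly_Mapping.single t (Poly_Mapping.lookup p t))"
  by (rule poly_mapping_eqI)
    (auto simp: lookup_sum lookup_single when_def sum.If_cases in_keys_iff sum.delta')

lemma subring_set_mpol_set: "subring_set (mpol_set n :: 'k::field mpol set)"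
proof
  show "(1 :: 'k mpol) \<in> mpol_set n"
    by (simp add: mpol_set_def)
next
  fix p q :: "'k mpol" assume *: "p \<in> mpol_set n" "q \<in> mpol_set n"
  then show "p + q \<in> mpol_set n"
    using Poly_Mapping.keys_add[of p q] by (auto simp: mpol_set_def)
  show "p * q \<in> mpol_set n"
    unfolding mpol_set_def
  proof (rule CollectI, rule ballI)
    fix t assume "t \<in> Poly_Mapping.keys (p * q)"
    then obtain a b where ab: "a \<in> Poly_Mapping.keys p" "b \<in> Poly_Mapping.keys q" "t = a + b"
      using keys_mult by blast
    then show "Poly_Mapping.keys t \<subseteq> {..<n}"
      using * Poly_Mapping.keys_add[of a b] by (force simp: mpol_set_def)
  qed
next
  fix p :: "'k mpol" assume "p \<in> mpol_set n"
  then show "- p \<in> mpol_set n"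
    by (simp add: mpol_set_def in_keys_iff)
qed

text \<open>
  Every polynomial is a sum of monomials, each a constant times a product of variables. The lemma
  reduces identities between derivations on polynomials to constants and variables.
\<close>

lemma mpol_set_subset:
  assumes S: "subring_set S" and c: "constants \<subseteq> S" and x: "\<And>i. i < n \<Longrightarrow> mvar i \<in> S"
  shows "mpol_set n \<subseteq> S"
proof
  interpret subring_set S by (rule S)
  fix p :: "'a mpol" assume p: "p \<in> mpol_set n"
  have pow: "Poly_Mapping.single (Poly_Mapping.single i k) 1 \<in> S" if "i < n" for i k
  proof (induction k)
    case 0
    then show ?case using one_closed by simp
  next
    case (Suc k)
    have "Poly_Mapping.single (Poly_Mapping.single i (Suc k)) (1::'a)
      = mvar i * Poly_Mapping.single (Poly_Mapping.single i k) 1"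
      by (simp add: mvar_def mult_single flip: single_add)
    then show ?case using Suc x[OF that] mult_closed by simp
  qed
  have mon: "Poly_Mapping.single (\<Sum>i\<in>K. Poly_Mapping.single i (g i)) a \<in> S"
    if "finite K" "K \<subseteq> {..<n}" for K g a
    using that
  proof (induction K)
    case empty
    then show ?case using c by (auto simp: constants_def)
  next
    case (insert i K)
    have "Poly_Mapping.single (\<Sum>i\<in>insert i K. Poly_Mapping.single i (g i)) a
      = Poly_Mapping.single (Poly_Mapping.single i (g i)) 1
        * Poly_Mapping.single (\<Sum>i\<in>K. Poly_Mapping.single i (g i)) a"
      using insert.hyps by (simp add: mult_single)
    then show ?case using insert pow mult_closed by auto
  qed
  have "Poly_Mapping.single t a \<in> S" if "t \<in> Poly_Mapping.keys p" for t a
  proof -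
    have "t = (\<Sum>i\<in>Poly_Mapping.keys t. Poly_Mapping.single i (Poly_Mapping.lookup t i))"
      by (rule poly_mapping_eqI) (auto simp: lookup_sum lookup_single when_def in_keys_iff sum.delta')
    then show ?thesis
      using mon[of "Poly_Mapping.keys t" "Poly_Mapping.lookup t" a] that p by (auto simp: mpol_set_def)
  qed
  then show "p \<in> S"
    by (subst mpol_sum_monomials) (auto intro: sum_closed)
qed

lemma partial_deriv_superset:
  assumes "finite T" "Poly_Mapping.keys p \<subseteq> T"
  shows "partial_deriv i p = (\<Sum>t\<in>T. Poly_Mapping.single (t - Poly_Mapping.single i 1)
         (of_nat (Poly_Mapping.lookup t i) * Poly_Mapping.lookup p t))"
  unfolding partial_deriv_def
  by (rule sum.mono_neutral_left) (use assms in \<open>auto simp: in_keys_iff\<close>)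

lemma partial_deriv_add: "partial_deriv i (p + q) = partial_deriv i p + partial_deriv i q"
proof -
  let ?T = "Poly_Mapping.keys p \<union> Poly_Mapping.keys q"
  have "Poly_Mapping.keys (p + q) \<subseteq> ?T" by (rule Poly_Mapping.keys_add)
  then show ?thesis
    by (simp add: partial_deriv_superset[of ?T] lookup_add distrib_left single_add sum.distrib)
qed

lemma partial_deriv_single:
  "partial_deriv i (Poly_Mapping.single t c)
    = Poly_Mapping.single (t - Poly_Mapping.single i 1) (of_nat (Poly_Mapping.lookup t i) * c)"
  by (subst partial_deriv_superset[of "{t}"]) auto

lemma partial_deriv_zero [simp]: "partial_deriv i 0 = 0"
  by (simp add: partial_deriv_def)

lemma partial_deriv_sum: "partial_deriv i (sum g T) = (\<Sum>t\<in>T. partial_deriv i (g t))"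
  by (induction T rule: infinite_finite_induct) (auto simp: partial_deriv_add)

text \<open>
  The truncated subtraction of exponents differs from the true one only where the coefficient
  vanishes.
\<close>

lemma single_shift_exponent:
  fixes s t :: "nat \<Rightarrow>\<^sub>0 nat"
  shows "Poly_Mapping.single (t + (s - Poly_Mapping.single i 1)) (of_nat (Poly_Mapping.lookup s i) * c)
    = Poly_Mapping.single (t + s - Poly_Mapping.single i 1)
        (of_nat (Poly_Mapping.lookup s i) * c :: 'k::field)"
proof (cases "Poly_Mapping.lookup s i = 0")
  case False
  then have "t + (s - Poly_Mapping.single i 1) = t + s - Poly_Mapping.single i 1"
    by (intro poly_mapping_eqI) (auto simp: lookup_add lookup_minus lookup_single when_def)
  then show ?thesis by simp
qed simp

lemma partial_deriv_mult_single:
  "partial_deriv i (Poly_Mapping.single t c * Poly_Mapping.single s d)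
    = Poly_Mapping.single t c * partial_deriv i (Poly_Mapping.single s d)
      + Poly_Mapping.single s d * partial_deriv i (Poly_Mapping.single t c)"
  using single_shift_exponent[of t s i "c * d"] single_shift_exponent[of s t i "c * d"]
  by (simp add: partial_deriv_single mult_single lookup_add algebra_simps single_add)

lemma partial_deriv_mult: "partial_deriv i (p * q) = p * partial_deriv i q + q * partial_deriv i p"
proof -
  let ?s = "\<lambda>p t. Poly_Mapping.single t (Poly_Mapping.lookup p t)"
  let ?p = "\<Sum>t\<in>Poly_Mapping.keys p. ?s p t" and ?q = "\<Sum>t\<in>Poly_Mapping.keys q. ?s q t"
  have "partial_deriv i (?p * ?q) = ?p * partial_deriv i ?q + ?q * partial_deriv i ?p"
    by (simp add: sum_product partial_deriv_sum partial_deriv_mult_single sum.distrib)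
       (rule sum.swap)
  then show ?thesis by (simp only: mpol_sum_monomials[symmetric])
qed

lemma derivation_on_partial_deriv: "derivation_on S (partial_deriv i)"
  by (simp add: derivation_on_def partial_deriv_add partial_deriv_mult)

lemma partial_deriv_constant: "c \<in> constants \<Longrightarrow> partial_deriv i c = 0"
  by (auto simp: constants_def partial_deriv_single)

lemma partial_deriv_mvar: "partial_deriv i (mvar j) = (if i = j then 1 else 0)"
  by (auto simp: mvar_def partial_deriv_single lookup_single when_def)

lemma partial_deriv_closed:
  assumes "p \<in> mpol_set n" shows "partial_deriv i p \<in> mpol_set n"
  unfolding partial_deriv_def
proof (rule subring_set.sum_closed[OF subring_set_mpol_set])
  fix t assume "t \<in> Poly_Mapping.keys p"
  with assms have "Poly_Mapping.keys t \<subseteq> {..<n}"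
    by (simp add: mpol_set_def)
  moreover have "Poly_Mapping.keys (t - Poly_Mapping.single i 1) \<subseteq> Poly_Mapping.keys t"
    by (auto simp add: in_keys_iff lookup_minus)
  ultimately have "Poly_Mapping.keys (t - Poly_Mapping.single i 1) \<subseteq> {..<n}"
    by blast
  then show "Poly_Mapping.single (t - Poly_Mapping.single i 1)
      (of_nat (Poly_Mapping.lookup t i) * Poly_Mapping.lookup p t) \<in> mpol_set n"
    by (auto simp: mpol_set_def)
qed

text \<open>
  Both sides are derivations that agree on constants and variables, so they agree on a subring that
  contains all polynomials.
\<close>

lemma derivation_chain_rule:
  assumes S: "subring_set S" and D: "derivation_on S D"
    and c: "constants \<subseteq> S" "\<And>c. c \<in> constants \<Longrightarrow> D c = 0"
    and x: "\<And>i. i < n \<Longrightarrow> mvar i \<in> S" and p: "p \<in> mpol_set n"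
  shows "D p = (\<Sum>i<n. partial_deriv i p * D (mvar i))"
proof -
  interpret subring_set S by (rule S)
  interpret U: subring_set UNIV by (rule subring_set_UNIV)
  define T where "T = {p \<in> S. D p = (\<Sum>i<n. partial_deriv i p * D (mvar i))}"
  note D' = derivation_onD[OF D]
  have cT: "constants \<subseteq> T"
    using c by (auto simp: T_def partial_deriv_constant)
  have neg: "D (- a) = - D a" if "a \<in> S" for a
    using derivation_on_diff[OF D zero_closed that] derivation_on_zero[OF D] by simp
  have neg': "partial_deriv i (- a) = - partial_deriv i a" for i and a :: "'a mpol"
    using U.derivation_on_diff[OF derivation_on_partial_deriv, of 0 a i] by simp
  have "subring_set T"
  proof
    have "(1 :: 'a mpol) \<in> constants"
      unfolding constants_def by (rule image_eqI[of _ _ 1]) auto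
    then show "1 \<in> T" using cT by blast
    fix a b assume "a \<in> T" "b \<in> T"
    then show "a + b \<in> T" "a * b \<in> T" "- a \<in> T"
      by (auto simp: T_def closed D' partial_deriv_add partial_deriv_mult sum.distrib
        sum_distrib_left algebra_simps neg neg' sum_negf)
  qed
  moreover have "mvar i \<in> T" if "i < n" for i
    using that x by (simp add: T_def partial_deriv_mvar if_distrib[of "\<lambda>z. z * _"] cong: if_cong)
  ultimately have "mpol_set n \<subseteq> T"
    using mpol_set_subset cT by blast
  then show ?thesis using p by (auto simp: T_def)
qed

section \<open>Spans and quotients of modules\<close>

lemma (in module) submodule_span_least:
  assumes "submodule N R M" "Y \<subseteq> N"
  shows "submodule_span R M Y \<subseteq> N"
  using assms by (auto simp: submodule_span_def)

lemma (in module) submodule_span_incl: "Y \<subseteq> submodule_span R M Y"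
  by (auto simp: submodule_span_def)

lemma (in module) submodule_span_is_submodule:
  assumes "Y \<subseteq> carrier M"
  shows "submodule (submodule_span R M Y) R M"
proof (rule submoduleI)
  show "submodule_span R M Y \<subseteq> carrier M"
    using submodule_span_least[OF carrier_is_submodule assms] .
  have zero: "\<zero>\<^bsub>M\<^esub> \<in> N" if "submodule N R M" for N
    using subgroup.one_closed[OF submodule.axioms(1)[OF that]] by simp
  show "\<zero>\<^bsub>M\<^esub> \<in> submodule_span R M Y"
    using zero by (auto simp: submodule_span_def)
qed (auto simp: submodule_span_def submoduleE)

locale module_with_submodule = module R M for R (structure) and M (structure) +
  fixes N
  assumes submod: "submodule N R M"
begin

lemma additive: "abelian_subgroup N M"
proof (rule abelian_subgroupI3)
  show "additive_subgroup N M"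
    by (rule additive_subgroup.intro) (rule submodule.axioms(1)[OF submod])
qed (rule abelian_group_axioms)

sublocale N: abelian_subgroup N M by (rule additive)

lemma coset_eq_iff:
  assumes "x \<in> carrier M" "y \<in> carrier M"
  shows "N +>\<^bsub>M\<^esub> x = N +>\<^bsub>M\<^esub> y \<longleftrightarrow> x \<ominus>\<^bsub>M\<^esub> y \<in> N"
proof
  assume "N +>\<^bsub>M\<^esub> x = N +>\<^bsub>M\<^esub> y"
  then have "x \<in> N +>\<^bsub>M\<^esub> y" using N.a_rcos_self assms by blast
  then show "x \<ominus>\<^bsub>M\<^esub> y \<in> N"
    using N.a_rcos_module_imp assms by (simp add: a_minus_def)
next
  assume "x \<ominus>\<^bsub>M\<^esub> y \<in> N"
  then have "x \<in> N +>\<^bsub>M\<^esub> y"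
    using N.a_rcos_module_rev assms by (simp add: a_minus_def)
  then show "N +>\<^bsub>M\<^esub> x = N +>\<^bsub>M\<^esub> y"
    using N.a_repr_independence' assms by blast
qed

lemma coset_eq_zero_iff:
  assumes "x \<in> carrier M"
  shows "N +>\<^bsub>M\<^esub> x = N \<longleftrightarrow> x \<in> N"
  using coset_eq_iff[OF assms M.zero_closed] M.a_coset_add_zero[OF N.a_subset]
    M.minus_equality[of "\<zero>\<^bsub>M\<^esub>" "\<zero>\<^bsub>M\<^esub>"] assms
  by (simp add: a_minus_def)

lemma quotient_simps:
  "carrier (quotient_module M N) = (\<lambda>x. N +>\<^bsub>M\<^esub> x) ` carrier M"
  "\<zero>\<^bsub>quotient_module M N\<^esub> = N"
  by (auto simp: quotient_module_def A_RCOSETS_def RCOSETS_def a_r_coset_def)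

lemma quotient_add:
  assumes "x \<in> carrier M" "y \<in> carrier M"
  shows "(N +>\<^bsub>M\<^esub> x) \<oplus>\<^bsub>quotient_module M N\<^esub> (N +>\<^bsub>M\<^esub> y) = N +>\<^bsub>M\<^esub> (x \<oplus>\<^bsub>M\<^esub> y)"
  using N.a_rcos_sum[OF assms] by (simp add: quotient_module_def)

lemma quotient_smult:
  assumes c: "c \<in> carrier R" and x: "x \<in> carrier M"
  shows "c \<odot>\<^bsub>quotient_module M N\<^esub> (N +>\<^bsub>M\<^esub> x) = N +>\<^bsub>M\<^esub> (c \<odot>\<^bsub>M\<^esub> x)"
proof -
  have eq: "N +>\<^bsub>M\<^esub> (c \<odot>\<^bsub>M\<^esub> y) = N +>\<^bsub>M\<^esub> (c \<odot>\<^bsub>M\<^esub> x)" if y: "y \<in> N +>\<^bsub>M\<^esub> x" for y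
  proof -
    have yM: "y \<in> carrier M" using N.a_elemrcos_carrier x y by blast
    have "y \<ominus>\<^bsub>M\<^esub> x \<in> N"
      using N.a_rcos_module_imp x y by (simp add: a_minus_def)
    then have "c \<odot>\<^bsub>M\<^esub> (y \<ominus>\<^bsub>M\<^esub> x) \<in> N"
      using submoduleE(4)[OF submod] c by blast
    also have "c \<odot>\<^bsub>M\<^esub> (y \<ominus>\<^bsub>M\<^esub> x) = c \<odot>\<^bsub>M\<^esub> y \<ominus>\<^bsub>M\<^esub> c \<odot>\<^bsub>M\<^esub> x"
      unfolding a_minus_def
      using smult_r_distr[OF c yM M.a_inv_closed[OF x]] smult_r_minus[OF c x] by (rule trans[OF _ arg_cong])
    finally show ?thesis
      using coset_eq_iff[OF smult_closed[OF c yM] smult_closed[OF c x]] by blast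
  qed
  have "N +>\<^bsub>M\<^esub> x \<noteq> {}" using N.a_rcos_self[OF x] by blast
  then have "(\<Union>y\<in>N +>\<^bsub>M\<^esub> x. N +>\<^bsub>M\<^esub> (c \<odot>\<^bsub>M\<^esub> y)) = N +>\<^bsub>M\<^esub> (c \<odot>\<^bsub>M\<^esub> x)"
    by (rule SUP_eq_const) (rule eq)
  then show ?thesis by (simp add: quotient_module_def)
qed

lemma quotient_is_module: "module R (quotient_module M N)"
proof (rule moduleI)
  have N0: "N = N +>\<^bsub>M\<^esub> \<zero>\<^bsub>M\<^esub>"
    using coset_eq_zero_iff[OF M.zero_closed] N.zero_closed by blast
  show "abelian_group (quotient_module M N)"
  proof (rule abelian_groupI)
    show "\<zero>\<^bsub>quotient_module M N\<^esub> \<in> carrier (quotient_module M N)"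
      using N0 by (auto simp: quotient_simps)
    fix C assume "C \<in> carrier (quotient_module M N)"
    then obtain x where x: "x \<in> carrier M" "C = N +>\<^bsub>M\<^esub> x"
      by (auto simp: quotient_simps)
    show "\<exists>B\<in>carrier (quotient_module M N). B \<oplus>\<^bsub>quotient_module M N\<^esub> C = \<zero>\<^bsub>quotient_module M N\<^esub>"
      using x N0 by (intro bexI[of _ "N +>\<^bsub>M\<^esub> (\<ominus>\<^bsub>M\<^esub> x)"])
        (auto simp: quotient_add quotient_simps M.l_neg)
    have "\<zero>\<^bsub>quotient_module M N\<^esub> \<oplus>\<^bsub>quotient_module M N\<^esub> C
        = (N +>\<^bsub>M\<^esub> \<zero>\<^bsub>M\<^esub>) \<oplus>\<^bsub>quotient_module M N\<^esub> (N +>\<^bsub>M\<^esub> x)"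
      using N0 x(2) by (simp add: quotient_simps)
    also have "\<dots> = C"
      using x by (simp only: quotient_add M.zero_closed M.l_zero)
    finally show "\<zero>\<^bsub>quotient_module M N\<^esub> \<oplus>\<^bsub>quotient_module M N\<^esub> C = C" .
  qed (auto simp: quotient_simps quotient_add M.a_ac)
qed (auto simp: quotient_simps quotient_add quotient_smult smult_l_distr smult_r_distr smult_assoc1
    R.is_cring)

lemma quotient_finsum:
  assumes "finite I" "\<And>i. i \<in> I \<Longrightarrow> g i \<in> carrier M"
  shows "(\<Oplus>\<^bsub>quotient_module M N\<^esub>i\<in>I. N +>\<^bsub>M\<^esub> g i) = N +>\<^bsub>M\<^esub> (\<Oplus>\<^bsub>M\<^esub>i\<in>I. g i)"
proof -
  interpret Q: module R "quotient_module M N" by (rule quotient_is_module)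
  have 0: "N +>\<^bsub>M\<^esub> \<zero>\<^bsub>M\<^esub> = N"
    by (simp add: coset_eq_zero_iff)
  show ?thesis
    using assms
  proof (induction I)
    case empty
    then show ?case by (simp add: quotient_simps 0)
  next
    case (insert i I)
    then have "g \<in> I \<rightarrow> carrier M" "(\<lambda>i. N +>\<^bsub>M\<^esub> g i) \<in> I \<rightarrow> carrier (quotient_module M N)"
      by (auto simp: quotient_simps)
    then show ?case
      using insert by (simp add: Q.finsum_insert M.finsum_insert quotient_simps quotient_add)
  qed
qed

lemma linear_map_factors_through_quotient:
  assumes h: "h \<in> linear_maps R M P" and P: "abelian_group P"
    and N0: "\<And>x. x \<in> N \<Longrightarrow> h x = \<zero>\<^bsub>P\<^esub>"
  shows "\<exists>l\<in>linear_maps R (quotient_module M N) P. \<forall>x\<in>carrier M. l (N +>\<^bsub>M\<^esub> x) = h x"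
proof -
  interpret P: abelian_group P by (rule P)
  have hc: "h x \<in> carrier P" if "x \<in> carrier M" for x
    using h that by (auto simp: linear_maps_def hom_def)
  have ha: "h (x \<oplus>\<^bsub>M\<^esub> y) = h x \<oplus>\<^bsub>P\<^esub> h y" if "x \<in> carrier M" "y \<in> carrier M" for x y
    using h that by (auto simp: linear_maps_def hom_def)
  have hs: "h (c \<odot>\<^bsub>M\<^esub> x) = c \<odot>\<^bsub>P\<^esub> h x" if "c \<in> carrier R" "x \<in> carrier M" for c x
    using h that by (auto simp: linear_maps_def)
  define l where "l C = h (SOME x. x \<in> C)" for C
  have l: "l (N +>\<^bsub>M\<^esub> x) = h x" if x: "x \<in> carrier M" for x
  proof -
    let ?y = "SOME y. y \<in> N +>\<^bsub>M\<^esub> x"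
    have y: "?y \<in> N +>\<^bsub>M\<^esub> x"
      by (rule someI[of _ x]) (rule N.a_rcos_self[OF x])
    have yM: "?y \<in> carrier M" using N.a_elemrcos_carrier x y by blast
    have d: "?y \<ominus>\<^bsub>M\<^esub> x \<in> N"
      using N.a_rcos_module_imp x y by (simp add: a_minus_def)
    have "(?y \<ominus>\<^bsub>M\<^esub> x) \<oplus>\<^bsub>M\<^esub> x = ?y"
      using x yM by (simp add: a_minus_def M.a_assoc M.l_neg)
    then have "h ?y = h (?y \<ominus>\<^bsub>M\<^esub> x) \<oplus>\<^bsub>P\<^esub> h x"
      using ha[of "?y \<ominus>\<^bsub>M\<^esub> x" x] x yM by simp
    then show ?thesis
      using N0[OF d] hc[OF x] by (simp add: l_def)
  qed
  have "l \<in> linear_maps R (quotient_module M N) P"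
    by (auto simp: linear_maps_def hom_def quotient_simps quotient_add quotient_smult l hc ha hs)
  with l show ?thesis by blast
qed

end

section \<open>Free modules over a subring\<close>

definition ring_on :: "'r::idom set \<Rightarrow> 'r ring" where
  "ring_on S = ring_of_type_algebra\<lparr>carrier := S\<rparr>"

lemma ring_on_simps [simp]:
  "carrier (ring_on S) = S" "\<zero>\<^bsub>ring_on S\<^esub> = 0" "\<one>\<^bsub>ring_on S\<^esub> = 1"
  "a \<oplus>\<^bsub>ring_on S\<^esub> b = a + b" "a \<otimes>\<^bsub>ring_on S\<^esub> b = a * b"
  by (simp_all add: ring_on_def ring_of_type_algebra_def)

lemma free_module_on_simps [simp]:
  "carrier (free_module (ring_on S) I) =
    {v. (\<forall>i\<in>I. v i \<in> S) \<and> (\<forall>i. i \<notin> I \<longrightarrow> v i = 0) \<and> finite {i. v i \<noteq> 0}}"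
  "\<zero>\<^bsub>free_module (ring_on S) I\<^esub> = (\<lambda>i. 0)"
  "u \<oplus>\<^bsub>free_module (ring_on S) I\<^esub> v = (\<lambda>i. u i + v i)"
  "c \<odot>\<^bsub>free_module (ring_on S) I\<^esub> v = (\<lambda>i. c * v i)"
  by (simp_all add: free_module_def)

lemma basis_vec_ring_on: "basis_vec (ring_on S) j = (\<lambda>i. if i = j then 1 else 0)"
  by (auto simp: basis_vec_def)

context subring_set
begin

lemma cring_ring_on: "cring (ring_on S)"
proof (rule cringI)
  show "abelian_group (ring_on S)"
    by (rule abelian_groupI) (auto simp: closed intro!: bexI[of _ "- _"])
  show "comm_monoid (ring_on S)"
    by (rule comm_monoidI) (auto simp: closed)
qed (auto simp: algebra_simps)

lemma a_inv_ring_on: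
  assumes "a \<in> S" shows "\<ominus>\<^bsub>ring_on S\<^esub> a = - a"
proof -
  interpret cring "ring_on S" by (rule cring_ring_on)
  show ?thesis
    using minus_equality[of "- a" a] assms by (simp add: closed)
qed

lemma free_module_on_is_module:
  fixes I :: "'i set"
  shows "module (ring_on S) (free_module (ring_on S) I)"
proof (rule moduleI)
  show "cring (ring_on S)" by (rule cring_ring_on)
  have fin: "finite {i. u i + v i \<noteq> 0}"
    if "finite {i. u i \<noteq> 0}" "finite {i. v i \<noteq> 0}" for u v :: "'i \<Rightarrow> 'r"
    by (rule finite_subset[OF _ finite_UnI[OF that]]) auto
  show "abelian_group (free_module (ring_on S) I)"
  proof (rule abelian_groupI)
    fix v assume "v \<in> carrier (free_module (ring_on S) I)"
    then show "\<exists>w\<in>carrier (free_module (ring_on S) I).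
        w \<oplus>\<^bsub>free_module (ring_on S) I\<^esub> v = \<zero>\<^bsub>free_module (ring_on S) I\<^esub>"
      by (intro bexI[of _ "\<lambda>i. - v i"]) (auto simp: closed)
  qed (auto simp: closed fin algebra_simps)
  fix a v assume *: "a \<in> carrier (ring_on S)" "v \<in> carrier (free_module (ring_on S) I)"
  then have "finite {i. v i \<noteq> 0}" by simp
  then have "finite {i. a * v i \<noteq> 0}" by (rule rev_finite_subset) auto
  with * show "a \<odot>\<^bsub>free_module (ring_on S) I\<^esub> v \<in> carrier (free_module (ring_on S) I)"
    by (auto simp: closed)
qed (auto simp: algebra_simps)

lemma free_module_on_minus:
  assumes "u \<in> carrier (free_module (ring_on S) I)" "v \<in> carrier (free_module (ring_on S) I)"
  shows "u \<ominus>\<^bsub>free_module (ring_on S) I\<^esub> v = (\<lambda>i. u i - v i)"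
proof -
  interpret module "ring_on S" "free_module (ring_on S) I" by (rule free_module_on_is_module)
  have "\<ominus>\<^bsub>free_module (ring_on S) I\<^esub> v = (\<lambda>i. - v i)"
    using M.minus_equality[of "\<lambda>i. - v i" v] assms(2) by (auto simp: closed)
  then show ?thesis by (simp add: a_minus_def)
qed

end

text \<open>
  The additive structure is only required to be pointwise, so this covers free modules as well as
  their submodules with a restricted carrier.
\<close>

lemma pointwise_finsum:
  assumes G: "abelian_monoid G"
    and zero: "\<zero>\<^bsub>G\<^esub> = (\<lambda>i. 0)" and add: "\<And>u v. u \<oplus>\<^bsub>G\<^esub> v = (\<lambda>i. u i + v i)"
    and "finite I" "\<And>j. j \<in> I \<Longrightarrow> g j \<in> carrier G"
  shows "(\<Oplus>\<^bsub>G\<^esub>j\<in>I. g j) = (\<lambda>i. \<Sum>j\<in>I. g j i :: 'r::comm_monoid_add)"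
proof -
  interpret abelian_monoid G by (rule G)
  show ?thesis
    using assms(4,5)
  proof (induction I)
    case (insert j I)
    then have "g \<in> I \<rightarrow> carrier G" by auto
    with insert show ?case by (simp add: finsum_insert add)
  qed (simp add: zero)
qed

section \<open>Kaehler differentials of a subring\<close>

definition unit_vec :: "'r \<Rightarrow> 'r \<Rightarrow> 'r::idom" where
  "unit_vec a = (\<lambda>x. if x = a then 1 else 0)"

text \<open>
  The representative of \<open>\<Sum>j. w\<^sub>j d g\<^sub>j\<close> in the free module on the symbols \<open>d a\<close>.
\<close>

definition generator_comb :: "nat \<Rightarrow> (nat \<Rightarrow> 'r) \<Rightarrow> (nat \<Rightarrow> 'r) \<Rightarrow> 'r \<Rightarrow> 'r::idom" where
  "generator_comb m g w = (\<lambda>x. \<Sum>j<m. w j * unit_vec (g j) x)"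

text \<open>
  The linear extension of \<open>d a \<mapsto> \<delta> a\<close> to the free module on the symbols \<open>d a\<close>.
\<close>

definition linear_ext :: "('r \<Rightarrow> 'r) \<Rightarrow> ('r \<Rightarrow> 'r) \<Rightarrow> 'r::idom" where
  "linear_ext \<delta> v = (\<Sum>a | v a \<noteq> 0. v a * \<delta> a)"

lemma linear_ext_superset:
  assumes "finite T" "{a. v a \<noteq> 0} \<subseteq> T"
  shows "linear_ext \<delta> v = (\<Sum>a\<in>T. v a * \<delta> a)"
  unfolding linear_ext_def by (rule sum.mono_neutral_left) (use assms in auto)

lemma linear_ext_add:
  assumes "finite {a. u a \<noteq> 0}" "finite {a. v a \<noteq> 0}"
  shows "linear_ext \<delta> (\<lambda>a. u a + v a) = linear_ext \<delta> u + linear_ext \<delta> v"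
proof -
  let ?T = "{a. u a \<noteq> 0} \<union> {a. v a \<noteq> 0}"
  have "finite ?T" using assms by simp
  moreover have "{a. u a + v a \<noteq> 0} \<subseteq> ?T" by auto
  ultimately show ?thesis
    by (simp add: linear_ext_superset[of ?T] sum.distrib distrib_right)
qed

lemma linear_ext_smult:
  assumes "finite {a. v a \<noteq> 0}"
  shows "linear_ext \<delta> (\<lambda>a. c * v a) = c * linear_ext \<delta> v"
proof -
  have "{a. c * v a \<noteq> 0} \<subseteq> {a. v a \<noteq> 0}" by auto
  then show ?thesis
    using assms by (simp add: linear_ext_superset[of "{a. v a \<noteq> 0}"] sum_distrib_left mult.assoc)
qed

lemma linear_ext_unit_vec: "linear_ext \<delta> (unit_vec a) = \<delta> a"
  by (subst linear_ext_superset[of "{a}"]) (auto simp: unit_vec_def)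

lemma linear_ext_zero: "linear_ext \<delta> (\<lambda>a. 0) = 0"
  by (simp add: linear_ext_def)

lemma finite_unit_vec: "finite {x. unit_vec a x \<noteq> 0}"
  by (rule finite_subset[of _ "{a}"]) (auto simp: unit_vec_def)

lemma finite_generator_comb: "finite {x. generator_comb m g w x \<noteq> 0}"
proof (rule finite_subset)
  show "{x. generator_comb m g w x \<noteq> 0} \<subseteq> g ` {..<m}"
  proof
    fix x assume "x \<in> {x. generator_comb m g w x \<noteq> 0}"
    then obtain j where "j < m" "w j * unit_vec (g j) x \<noteq> 0"
      unfolding generator_comb_def using sum.neutral[of "{..<m}" "\<lambda>j. w j * unit_vec (g j) x"] by auto
    then show "x \<in> g ` {..<m}" by (auto simp: unit_vec_def split: if_splits)
  qed
qed simp

lemma linear_ext_generator_comb: "linear_ext \<delta> (generator_comb m g w) = (\<Sum>j<m. w j * \<delta> (g j))"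
proof (induction m)
  case 0
  then show ?case by (simp add: generator_comb_def linear_ext_zero)
next
  case (Suc m)
  have "finite {a. w m * unit_vec (g m) a \<noteq> 0}"
    by (rule finite_subset[OF _ finite_unit_vec[of "g m"]]) auto
  then have "linear_ext \<delta> (\<lambda>x. generator_comb m g w x + w m * unit_vec (g m) x) = linear_ext \<delta> (generator_comb m g w) + w m * \<delta> (g m)"
    by (simp add: linear_ext_add finite_generator_comb linear_ext_smult finite_unit_vec linear_ext_unit_vec)
  with Suc show ?case by (simp add: generator_comb_def)
qed

locale kaehler_setting = subring_set S for S :: "'r::idom set" +
  fixes K
  assumes K: "subring_set K" "K \<subseteq> S"
begin

abbreviation F where "F \<equiv> free_module (ring_on S) S"
abbreviation N where "N \<equiv> kaehler_kernel K (ring_on S)"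

lemma unit_vec_F: "a \<in> S \<Longrightarrow> unit_vec a \<in> carrier F"
  using finite_unit_vec by (auto simp: unit_vec_def closed)

lemma basis_vec_unit_vec: "basis_vec (ring_on S) = unit_vec"
  by (rule ext) (simp add: unit_vec_def basis_vec_ring_on)

lemma kaehler_relations_eq:
  "kaehler_relations K (ring_on S) =
    (\<lambda>(a, b) x. unit_vec (a + b) x - (unit_vec a x + unit_vec b x)) ` (S \<times> S) \<union>
    (\<lambda>(a, b) x. unit_vec (a * b) x - (a * unit_vec b x + b * unit_vec a x)) ` (S \<times> S) \<union>
    unit_vec ` K"
proof -
  interpret M: module "ring_on S" F by (rule free_module_on_is_module)
  have im: "{h a b |a b. a \<in> S \<and> b \<in> S} = (\<lambda>(a, b). h a b) ` (S \<times> S)" for h :: "'r \<Rightarrow> 'r \<Rightarrow> 'r \<Rightarrow> 'r"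
    by auto
  have 1: "unit_vec (a + b) \<ominus>\<^bsub>F\<^esub> (unit_vec a \<oplus>\<^bsub>F\<^esub> unit_vec b)
      = (\<lambda>x. unit_vec (a + b) x - (unit_vec a x + unit_vec b x))" if "a \<in> S" "b \<in> S" for a b
    using free_module_on_minus[OF unit_vec_F[OF add_closed[OF that]]
        M.M.a_closed[OF unit_vec_F[OF that(1)] unit_vec_F[OF that(2)]]]
    by (simp only: free_module_on_simps(3))
  have 2: "unit_vec (a * b) \<ominus>\<^bsub>F\<^esub> (a \<odot>\<^bsub>F\<^esub> unit_vec b \<oplus>\<^bsub>F\<^esub> b \<odot>\<^bsub>F\<^esub> unit_vec a)
      = (\<lambda>x. unit_vec (a * b) x - (a * unit_vec b x + b * unit_vec a x))" if "a \<in> S" "b \<in> S" for a b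
  proof -
    have "a \<odot>\<^bsub>F\<^esub> unit_vec b \<oplus>\<^bsub>F\<^esub> b \<odot>\<^bsub>F\<^esub> unit_vec a \<in> carrier F"
      using that by (intro M.M.a_closed M.smult_closed unit_vec_F) simp_all
    from free_module_on_minus[OF unit_vec_F[OF mult_closed[OF that]] this] show ?thesis
      by (simp only: free_module_on_simps(3,4))
  qed
  show ?thesis
    unfolding kaehler_relations_def Let_def ring_on_simps basis_vec_unit_vec im
    by (intro arg_cong2[of _ _ _ _ "(\<union>)"] image_cong) (auto simp: 1 2 simp del: free_module_on_simps)
qed

lemma F_module: "module (ring_on S) F" by (rule free_module_on_is_module)

lemma kaehler_relations_F: "kaehler_relations K (ring_on S) \<subseteq> carrier F"
proof -
  interpret M: module "ring_on S" F by (rule F_module)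
  have a: "(\<lambda>x. u x + v x) \<in> carrier F" if "u \<in> carrier F" "v \<in> carrier F" for u v
    using M.M.a_closed[OF that] by (simp only: free_module_on_simps)
  have s: "(\<lambda>x. c * u x) \<in> carrier F" if "c \<in> S" "u \<in> carrier F" for u c
    using M.smult_closed[of c u] that by (simp only: free_module_on_simps ring_on_simps)
  have m: "(\<lambda>x. u x - v x) \<in> carrier F" if "u \<in> carrier F" "v \<in> carrier F" for u v
    using M.M.minus_closed[OF that] free_module_on_minus[OF that] by simp
  show ?thesis
    unfolding kaehler_relations_eq using K by (auto intro!: a s m unit_vec_F closed simp del: free_module_on_simps)
qed

lemma N_submodule: "submodule N (ring_on S) F"
  unfolding kaehler_kernel_def
  using module.submodule_span_is_submodule[OF F_module kaehler_relations_F] by simp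

sublocale Q: module_with_submodule "ring_on S" F N
  by (intro module_with_submodule.intro F_module module_with_submodule_axioms.intro N_submodule)

lemma N_add: "u \<in> N \<Longrightarrow> v \<in> N \<Longrightarrow> (\<lambda>x. u x + v x) \<in> N"
  using Q.submoduleE(5)[OF N_submodule] by simp

lemma N_smult: "c \<in> S \<Longrightarrow> v \<in> N \<Longrightarrow> (\<lambda>x. c * v x) \<in> N"
  using Q.submoduleE(4)[OF N_submodule] by simp

lemma N_diff:
  assumes "u \<in> N" "v \<in> N" shows "(\<lambda>x. u x - v x) \<in> N"
  using N_add[OF assms(1) N_smult[OF uminus_closed[OF one_closed] assms(2)]] by simp

lemma N_zero: "(\<lambda>x. 0) \<in> N"
  using Q.N.zero_closed by simp

lemma kaehler_relations_N: "kaehler_relations K (ring_on S) \<subseteq> N"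
  unfolding kaehler_kernel_def using Q.submodule_span_incl by simp

lemma N_relations:
  assumes "a \<in> S" "b \<in> S"
  shows "(\<lambda>x. unit_vec (a + b) x - (unit_vec a x + unit_vec b x)) \<in> N"
    and "(\<lambda>x. unit_vec (a * b) x - (a * unit_vec b x + b * unit_vec a x)) \<in> N"
  using kaehler_relations_N assms unfolding kaehler_relations_eq by fast+

lemma N_K: "c \<in> K \<Longrightarrow> unit_vec c \<in> N"
  using kaehler_relations_N unfolding kaehler_relations_eq by blast

lemma generator_comb_F:
  assumes "\<And>j. j < m \<Longrightarrow> g j \<in> S" "\<And>j. j < m \<Longrightarrow> w j \<in> S"
  shows "generator_comb m g w \<in> carrier F"
proof -
  have "generator_comb m g w x \<in> S" for x
    unfolding generator_comb_def using assms(2) by (auto intro!: sum_closed mult_closed simp: unit_vec_def closed)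
  moreover have "generator_comb m g w x = 0" if "x \<notin> S" for x
    unfolding generator_comb_def using assms(1) that by (auto intro!: sum.neutral simp: unit_vec_def)
  ultimately show ?thesis using finite_generator_comb[of m g w] by simp
qed

text \<open>
  The universal property of differentials: the linear extension of a derivation kills the three kinds
  of defining relations, hence the submodule that they span.
\<close>

lemma linear_ext_kernel:
  assumes D: "derivation_on S \<delta>" and K0: "\<And>c. c \<in> K \<Longrightarrow> \<delta> c = 0" and v: "v \<in> N"
  shows "linear_ext \<delta> v = 0"
proof -
  define Z where "Z = {v \<in> carrier F. linear_ext \<delta> v = 0}"
  have m1: "linear_ext \<delta> (\<lambda>a. - v a) = - linear_ext \<delta> v" if "finite {a. v a \<noteq> 0}" for v
    using linear_ext_smult[OF that, of \<delta> "-1"] by simp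
  have df: "linear_ext \<delta> (\<lambda>a. u a - v a) = linear_ext \<delta> u - linear_ext \<delta> v"
    if "finite {a. u a \<noteq> 0}" "finite {a. v a \<noteq> 0}" for u v
    using linear_ext_add[of u "\<lambda>a. - v a" \<delta>] m1[OF that(2)] that by simp
  have "submodule Z (ring_on S) F"
  proof (rule Q.submoduleI)
    show "Z \<subseteq> carrier F" by (auto simp: Z_def simp del: free_module_on_simps)
    show "\<zero>\<^bsub>F\<^esub> \<in> Z" by (simp add: Z_def linear_ext_zero closed)
    fix u assume u: "u \<in> Z"
    then have "u \<in> carrier F" "linear_ext \<delta> u = 0" "finite {a. u a \<noteq> 0}" by (auto simp: Z_def)
    moreover from this have "\<ominus>\<^bsub>F\<^esub> u = (\<lambda>x. - u x)"
      using free_module_on_minus[OF Q.M.zero_closed, of u] by (simp add: a_minus_def)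
    moreover have "\<ominus>\<^bsub>F\<^esub> u \<in> carrier F"
      using Q.M.a_inv_closed calculation(1) .
    ultimately show "\<ominus>\<^bsub>F\<^esub> u \<in> Z"
      by (simp add: Z_def m1 del: free_module_on_simps)
    fix v assume v: "v \<in> Z"
    with u have "u \<oplus>\<^bsub>F\<^esub> v \<in> carrier F"
      by (intro Q.M.a_closed) (auto simp: Z_def simp del: free_module_on_simps)
    with u v show "u \<oplus>\<^bsub>F\<^esub> v \<in> Z"
      by (simp add: Z_def linear_ext_add)
  next
    fix c u assume *: "c \<in> carrier (ring_on S)" "u \<in> Z"
    then have "c \<odot>\<^bsub>F\<^esub> u \<in> carrier F"
      by (intro Q.smult_closed) (auto simp: Z_def simp del: free_module_on_simps)
    with * show "c \<odot>\<^bsub>F\<^esub> u \<in> Z"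
      by (simp add: Z_def linear_ext_smult)
  qed
  moreover have "kaehler_relations K (ring_on S) \<subseteq> Z"
  proof
    fix r assume r: "r \<in> kaehler_relations K (ring_on S)"
    have f2: "finite {x. c * u x \<noteq> 0}" if "finite {x. u x \<noteq> 0}" for c and u :: "'r \<Rightarrow> 'r"
      by (rule finite_subset[OF _ that]) auto
    have f3: "finite {x. u x + v x \<noteq> 0}" if "finite {x. u x \<noteq> 0}" "finite {x. v x \<noteq> 0}"
      for u v :: "'r \<Rightarrow> 'r"
      by (rule finite_subset[OF _ finite_UnI[OF that]]) auto
    from r have "linear_ext \<delta> r = 0"
      unfolding kaehler_relations_eq using K0 K
      by (elim UnE imageE; clarsimp; subst df linear_ext_unit_vec linear_ext_add linear_ext_smult)
        (auto simp: finite_unit_vec f2 f3 linear_ext_unit_vec linear_ext_add linear_ext_smult derivation_onD[OF D]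
          simp del: mult_eq_0_iff add_eq_0_iff)
    with r kaehler_relations_F show "r \<in> Z" by (auto simp: Z_def simp del: free_module_on_simps)
  qed
  ultimately have "N \<subseteq> Z"
    unfolding kaehler_kernel_def ring_on_simps by (rule Q.submodule_span_least)
  with v show ?thesis by (auto simp: Z_def)
qed

text \<open>
  Apply \<open>separating_functional\<close> to the module \<open>W\<close> of relations among the \<open>d g\<^sub>j\<close>. The values \<open>u\<^sub>j\<close>
  obtained for \<open>d g\<^sub>j\<close> determine a functional on all differentials, since every \<open>d a\<close> is a
  combination of the \<open>d g\<^sub>j\<close>; the composite with \<open>d\<close> is the derivation.
\<close>

lemma nontorsion_derivation:
  assumes g: "\<And>j. j < m \<Longrightarrow> g j \<in> S"
    and gen: "\<And>T. subring_set T \<Longrightarrow> K \<subseteq> T \<Longrightarrow> (\<And>j. j < m \<Longrightarrow> g j \<in> T) \<Longrightarrow> S \<subseteq> T"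
    and v: "\<And>j. v j \<in> S" "\<And>j. j \<ge> m \<Longrightarrow> v j = 0"
    and nt: "\<And>c. c \<in> S \<Longrightarrow> c \<noteq> 0 \<Longrightarrow> (\<lambda>x. c * generator_comb m g v x) \<notin> N"
  shows "\<exists>D. derivation_on S D \<and> (\<forall>c\<in>K. D c = 0) \<and> (\<Sum>j<m. v j * D (g j)) \<noteq> 0"
proof -
  define V where "V = {w :: nat \<Rightarrow> 'r. (\<forall>j. w j \<in> S) \<and> (\<forall>j\<ge>m. w j = 0)}"
  define W where "W = {w \<in> V. generator_comb m g w \<in> N}"
  have cd: "generator_comb m g (\<lambda>j. w j - w' j) = (\<lambda>x. generator_comb m g w x - generator_comb m g w' x)" for w w'
    by (simp add: generator_comb_def left_diff_distrib sum_subtractf)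
  have ca: "generator_comb m g (\<lambda>j. w j + w' j) = (\<lambda>x. generator_comb m g w x + generator_comb m g w' x)" for w w'
    by (simp add: generator_comb_def distrib_right sum.distrib)
  have cs: "generator_comb m g (\<lambda>j. c * w j) = (\<lambda>x. c * generator_comb m g w x)" for c w
    by (simp add: generator_comb_def sum_distrib_left mult.assoc)
  have c0: "generator_comb m g (\<lambda>j. 0) = (\<lambda>x. 0)"
    by (simp add: generator_comb_def)
  have Vc: "(\<lambda>j. w j + w' j) \<in> V" "(\<lambda>j. w j - w' j) \<in> V" "(\<lambda>j. c * w j) \<in> V" "(\<lambda>j. 0) \<in> V"
    if "w \<in> V" "w' \<in> V" "c \<in> S" for w w' c
    using that by (auto simp: V_def closed)
  have "\<exists>u. (\<forall>w\<in>W. (\<Sum>j<m. w j * u j) = 0) \<and> (\<Sum>j<m. v j * u j) \<noteq> 0"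
  proof (rule separating_functional[of S])
    show "subring_set S" by unfold_locales
    show "(\<lambda>j. w j - w' j) \<in> W" if "w \<in> W" "w' \<in> W" for w w'
      using that N_diff Vc(2) zero_closed by (auto simp: W_def cd)
    show "(\<lambda>j. a * w j) \<in> W" if "a \<in> S" "w \<in> W" for a w
      using that N_smult Vc(3) by (auto simp: W_def cs)
    show "(\<lambda>j. 0) \<in> W"
      using N_zero zero_closed by (simp add: W_def c0 V_def)
    show "(\<lambda>j. a * v j) \<notin> W" if "a \<in> S" "a \<noteq> 0" for a
      using nt[OF that] by (simp add: W_def cs)
  qed (use v in \<open>auto simp: W_def V_def\<close>)
  then obtain u where u: "\<And>w. w \<in> W \<Longrightarrow> (\<Sum>j<m. w j * u j) = 0" and uv: "(\<Sum>j<m. v j * u j) \<noteq> 0"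
    by blast
  \<comment> \<open>\<open>rep a w\<close> means \<open>d a = (\<Sum>j. w\<^sub>j d g\<^sub>j)\<close> in the module of differentials.\<close>
  define rep where "rep a w \<longleftrightarrow> w \<in> V \<and> (\<lambda>x. unit_vec a x - generator_comb m g w x) \<in> N" for a w
  have repD: "(\<lambda>x. unit_vec a x - generator_comb m g w x) \<in> N" if "rep a w" for a w
    using that by (simp add: rep_def)
  have rep_add: "rep (a + b) (\<lambda>j. w j + w' j)"
    if "a \<in> S" "b \<in> S" "rep a w" "rep b w'" for a b w w'
  proof -
    have "(\<lambda>x. unit_vec (a + b) x - (unit_vec a x + unit_vec b x)
        + ((unit_vec a x - generator_comb m g w x) + (unit_vec b x - generator_comb m g w' x))) \<in> N"
      by (rule N_add[OF N_relations(1)[OF that(1,2)] N_add[OF repD[OF that(3)] repD[OF that(4)]]])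
    then show ?thesis
      using that Vc(1) zero_closed by (simp add: rep_def ca algebra_simps)
  qed
  have rep_mult: "rep (a * b) (\<lambda>j. a * w' j + b * w j)"
    if "a \<in> S" "b \<in> S" "rep a w" "rep b w'" for a b w w'
  proof -
    have "(\<lambda>x. unit_vec (a * b) x - (a * unit_vec b x + b * unit_vec a x)
        + (a * (unit_vec b x - generator_comb m g w' x) + b * (unit_vec a x - generator_comb m g w x))) \<in> N"
      by (rule N_add[OF N_relations(2)[OF that(1,2)]
          N_add[OF N_smult[OF that(1) repD[OF that(4)]] N_smult[OF that(2) repD[OF that(3)]]]])
    moreover have "generator_comb m g (\<lambda>j. a * w' j + b * w j) = (\<lambda>x. a * generator_comb m g w' x + b * generator_comb m g w x)"
      using ca[of "\<lambda>j. a * w' j" "\<lambda>j. b * w j"] by (simp add: cs)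
    moreover have "(\<lambda>j. a * w' j + b * w j) \<in> V"
      using that by (auto simp: rep_def V_def closed)
    ultimately show ?thesis
      by (simp add: rep_def algebra_simps)
  qed
  have rep_K: "rep c (\<lambda>j. 0)" if "c \<in> K" for c
    using N_K[OF that] zero_closed by (simp add: rep_def c0 V_def)
  have "S \<subseteq> {a \<in> S. \<exists>w. rep a w}"
  proof (rule gen)
    interpret K: subring_set K by (rule K)
    show "subring_set {a \<in> S. \<exists>w. rep a w}"
    proof
      show "1 \<in> {a \<in> S. \<exists>w. rep a w}"
        using rep_K[OF K.one_closed] one_closed by blast
      fix a b assume ab: "a \<in> {a \<in> S. \<exists>w. rep a w}" "b \<in> {a \<in> S. \<exists>w. rep a w}"
      then obtain w w' where r: "a \<in> S" "b \<in> S" "rep a w" "rep b w'" by blast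
      show "a + b \<in> {a \<in> S. \<exists>w. rep a w}"
        using add_closed[OF r(1,2)] rep_add[OF r] by blast
      show "a * b \<in> {a \<in> S. \<exists>w. rep a w}"
        using mult_closed[OF r(1,2)] rep_mult[OF r] by blast
      have "-1 \<in> K" by (intro K.closed)
      then have "rep (-1 * a) (\<lambda>j. -1 * w j + a * 0)"
        using K r by (intro rep_mult rep_K) auto
      then show "- a \<in> {a \<in> S. \<exists>w. rep a w}"
        using uminus_closed[OF r(1)] by auto
    qed
    show "K \<subseteq> {a \<in> S. \<exists>w. rep a w}" using rep_K K by blast
    fix j assume j: "j < m"
    define w where "w i = (if i = j then 1 else 0 :: 'r)" for i
    have "generator_comb m g w = unit_vec (g j)"
      using j by (simp add: generator_comb_def w_def if_distrib[of "\<lambda>z. z * _"] cong: if_cong)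
    then have "rep (g j) w"
      using N_zero j by (auto simp: rep_def V_def w_def closed)
    then show "g j \<in> {a \<in> S. \<exists>w. rep a w}" using g j by blast
  qed
  then have ex: "\<exists>w. rep a w" if "a \<in> S" for a using that by blast
  define D where "D a = (\<Sum>j<m. (SOME w. rep a w) j * u j)" for a
  have D: "D a = (\<Sum>j<m. w j * u j)" if "rep a w" for a w
  proof -
    let ?w = "SOME w. rep a w"
    have r: "rep a ?w" using someI[of "rep a"] that by blast
    have "(\<lambda>x. (unit_vec a x - generator_comb m g w x) - (unit_vec a x - generator_comb m g ?w x)) \<in> N"
      by (rule N_diff[OF repD[OF that] repD[OF r]])
    then have "(\<lambda>j. ?w j - w j) \<in> W"
      using that r Vc(2)[of ?w w] zero_closed by (simp add: W_def cd rep_def)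
    from u[OF this] show ?thesis
      by (simp add: D_def left_diff_distrib sum_subtractf)
  qed
  have "derivation_on S D"
    unfolding derivation_on_def
  proof (intro ballI)
    fix a b assume ab: "a \<in> S" "b \<in> S"
    obtain w w' where r: "rep a w" "rep b w'" using ex ab by blast
    show "D (a + b) = D a + D b \<and> D (a * b) = a * D b + b * D a"
      using D[OF rep_add[OF ab r]] D[OF rep_mult[OF ab r]] D[OF r(1)] D[OF r(2)]
      by (simp add: distrib_right sum.distrib sum_distrib_left mult.assoc)
  qed
  moreover have "D c = 0" if "c \<in> K" for c
    using D[OF rep_K[OF that]] by simp
  moreover have "D (g j) = u j" if j: "j < m" for j
  proof -
    define w where "w i = (if i = j then 1 else 0 :: 'r)" for i
    have "generator_comb m g w = unit_vec (g j)"
      using j by (simp add: generator_comb_def w_def if_distrib[of "\<lambda>z. z * _"] cong: if_cong)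
    then have "rep (g j) w"
      using N_zero j by (auto simp: rep_def V_def w_def closed)
    from D[OF this] show ?thesis
      using j by (simp add: w_def if_distrib[of "\<lambda>z. z * _"] cong: if_cong)
  qed
  then have "(\<Sum>j<m. v j * D (g j)) = (\<Sum>j<m. v j * u j)" by simp
  ultimately show ?thesis using uv by metis
qed

end

section \<open>Differentials of a polynomial algebra and the Jacobian module\<close>

lemma mpol_ring_eq: "mpol_ring n = ring_on (mpol_set n)"
  by (simp add: mpol_ring_def ring_on_def mpol_set_def)

lemma subring_set_constants: "subring_set (constants :: 'k::field mpol set)"
proof
  have one: "(1 :: 'k mpol) = Poly_Mapping.single 0 1" by simp
  show "(1 :: 'k mpol) \<in> constants"
    unfolding constants_def one by (rule rangeI)
  fix a b :: "'k mpol" assume "a \<in> constants" "b \<in> constants"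
  then obtain c d where cd: "a = Poly_Mapping.single 0 c" "b = Poly_Mapping.single 0 d"
    by (auto simp: constants_def)
  show "a + b \<in> constants" unfolding constants_def cd single_add[symmetric] by (rule rangeI)
  show "a * b \<in> constants" unfolding constants_def cd mult_single by auto
  show "- a \<in> constants" unfolding constants_def cd single_uminus[symmetric] by (rule rangeI)
qed

lemma constants_subset_mpol_set: "constants \<subseteq> mpol_set n"
  by (auto simp: constants_def mpol_set_def split: if_splits)

text \<open>
  The chain rule needs the values of the derivation at the variables, which usually lie outside
  \<open>S\<close>; hence \<open>D\<close> is extended first. The extension multiplies the sum by a nonzero factor,
  which can be cancelled.
\<close>

lemma derivation_vanishes_on_jacobian_syzygy:
  fixes S :: "'k::field_char_0 mpol set"
  assumes S: "subring_set S" "constants \<subseteq> S"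
    and D: "derivation_on S D" "\<And>c. c \<in> constants \<Longrightarrow> D c = 0"
    and f: "\<And>j. j < m \<Longrightarrow> f j \<in> S" "\<And>j. j < m \<Longrightarrow> f j \<in> mpol_set n"
    and jac: "\<And>i. i < n \<Longrightarrow> (\<Sum>j<m. v j * partial_deriv i (f j)) = 0"
  shows "(\<Sum>j<m. v j * D (f j)) = 0"
proof -
  obtain S' c D' where S': "subring_set S'" "S \<subseteq> S'" "mvar ` {..<n} \<subseteq> S'" "c \<noteq> 0"
    "derivation_on S' D'" "\<And>a. a \<in> S \<Longrightarrow> D' a = c * D a"
    using extend_derivation_finite[OF S(1) D(1), of "mvar ` {..<n}"] by auto
  have chain: "c * D (f j) = (\<Sum>i<n. partial_deriv i (f j) * D' (mvar i))" if j: "j < m" for j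
  proof -
    have "D' (f j) = (\<Sum>i<n. partial_deriv i (f j) * D' (mvar i))"
      by (rule derivation_chain_rule[OF S'(1,5)]) (use S S' D f j in auto)
    then show ?thesis using S'(6) f(1) j by simp
  qed
  have "c * (\<Sum>j<m. v j * D (f j)) = (\<Sum>j<m. v j * (c * D (f j)))"
    by (simp add: sum_distrib_left algebra_simps)
  also have "\<dots> = (\<Sum>j<m. \<Sum>i<n. v j * partial_deriv i (f j) * D' (mvar i))"
    by (simp add: chain sum_distrib_left mult.assoc)
  also have "\<dots> = (\<Sum>i<n. \<Sum>j<m. v j * partial_deriv i (f j) * D' (mvar i))"
    by (rule sum.swap)
  also have "\<dots> = (\<Sum>i<n. (\<Sum>j<m. v j * partial_deriv i (f j)) * D' (mvar i))"
    by (simp add: sum_distrib_right)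
  also have "\<dots> = 0" by (simp add: jac)
  finally show ?thesis using S'(4) by simp
qed

locale polynomial_family =
  fixes n m :: nat and f :: "nat \<Rightarrow> 'k::field_char_0 mpol"
  assumes f: "j < m \<Longrightarrow> f j \<in> mpol_set n"
begin

definition S where "S = generate_ring (mpol_ring n) (constants \<union> f ` {..<m})"
abbreviation R where "R \<equiv> mpol_set n :: 'k mpol set"

sublocale R: subring_set R by (rule subring_set_mpol_set)

lemma S_R: "S \<subseteq> R"
proof -
  interpret cring "ring_on R" by (rule R.cring_ring_on)
  show ?thesis
    unfolding S_def mpol_ring_eq using generate_ring_incl[of "constants \<union> f ` {..<m}"]
      f constants_subset_mpol_set by fastforce
qed

lemma subring_S: "subring_set S"
proof
  interpret cring "ring_on R" by (rule R.cring_ring_on)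
  show "1 \<in> S"
    using generate_ring.one[of "ring_on R"] by (simp add: S_def mpol_ring_eq)
  fix a b assume ab: "a \<in> S" "b \<in> S"
  then show "a + b \<in> S" "a * b \<in> S"
    using generate_ring.eng_add[of a "ring_on R"] generate_ring.eng_mult[of a "ring_on R"]
    by (simp_all add: S_def mpol_ring_eq)
  have "\<ominus>\<^bsub>ring_on R\<^esub> a \<in> S"
    using ab generate_ring.a_inv[of a "ring_on R"] by (simp add: S_def mpol_ring_eq)
  then show "- a \<in> S" using R.a_inv_ring_on[of a] S_R ab by auto
qed

lemma constants_S: "constants \<subseteq> S" and f_S: "j < m \<Longrightarrow> f j \<in> S"
  by (auto simp: S_def intro: generate_ring.incl)

lemma S_least:
  assumes T: "subring_set T" "constants \<subseteq> T" "\<And>j. j < m \<Longrightarrow> f j \<in> T"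
  shows "S \<subseteq> T"
proof
  fix a assume "a \<in> S"
  then show "a \<in> T"
    unfolding S_def
  proof (induction rule: generate_ring.induct)
    case (a_inv h)
    then have "\<ominus>\<^bsub>ring_on R\<^esub> h = - h" using R.a_inv_ring_on S_R S_def by auto
    with a_inv T show ?case by (simp add: mpol_ring_eq subring_set.closed)
  qed (use T in \<open>auto simp: mpol_ring_eq subring_set.closed\<close>)
qed

sublocale kaehler_setting S constants
  by (intro kaehler_setting.intro kaehler_setting_axioms.intro subring_S subring_set_constants constants_S)

lemma forms_algebra_eq: "forms_algebra n m f = ring_on S"
  by (simp add: forms_algebra_def S_def mpol_ring_eq ring_on_def)

lemma forms_kaehler_eq: "forms_kaehler n m f = quotient_module F N"
  by (simp add: forms_kaehler_def forms_algebra_eq kaehler_def)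

definition jacobian_span where
  "jacobian_span = submodule_span (ring_on R) (free_module (ring_on R) {..<n}) ((\<lambda>j. poly_diff n (f j)) ` {..<m})"

lemma jacobian_module_eq: "jacobian_module n m f = (free_module (ring_on R) {..<n})\<lparr>carrier := jacobian_span\<rparr>"
  by (simp add: jacobian_module_def jacobian_span_def mpol_ring_eq Let_def)

lemma jacobian_module_simps:
  "carrier (jacobian_module n m f) = jacobian_span"
  "\<zero>\<^bsub>jacobian_module n m f\<^esub> = (\<lambda>i. 0)"
  "u \<oplus>\<^bsub>jacobian_module n m f\<^esub> v = (\<lambda>i. u i + v i)"
  "c \<odot>\<^bsub>jacobian_module n m f\<^esub> v = (\<lambda>i. c * v i)"
  by (simp_all add: jacobian_module_eq)

lemma poly_diff_carrier:
  assumes "p \<in> R" shows "poly_diff n p \<in> carrier (free_module (ring_on R) {..<n})"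
proof -
  have "finite {i. poly_diff n p i \<noteq> 0}"
    by (rule finite_subset[of _ "{..<n}"]) (auto simp: poly_diff_def)
  then show ?thesis using partial_deriv_closed[OF assms] by (auto simp: poly_diff_def)
qed

lemma jacobian_span_submodule: "submodule jacobian_span (ring_on R) (free_module (ring_on R) {..<n})"
proof -
  interpret M: module "ring_on R" "free_module (ring_on R) {..<n}" by (rule R.free_module_on_is_module)
  show ?thesis
    unfolding jacobian_span_def using f poly_diff_carrier by (intro M.submodule_span_is_submodule) blast
qed

lemma jacobian_module: "module (ring_on R) (jacobian_module n m f)"
  unfolding jacobian_module_eq
  by (rule submodule.submodule_is_module[OF jacobian_span_submodule R.free_module_on_is_module])

lemma jacobian_span_closed:
  "u \<in> jacobian_span \<Longrightarrow> v \<in> jacobian_span \<Longrightarrow> (\<lambda>i. u i + v i) \<in> jacobian_span"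
  "c \<in> R \<Longrightarrow> u \<in> jacobian_span \<Longrightarrow> (\<lambda>i. c * u i) \<in> jacobian_span"
  "(\<lambda>i. 0) \<in> jacobian_span"
proof -
  interpret M: module "ring_on R" "jacobian_module n m f" by (rule jacobian_module)
  show "u \<in> jacobian_span \<Longrightarrow> v \<in> jacobian_span \<Longrightarrow> (\<lambda>i. u i + v i) \<in> jacobian_span"
    "c \<in> R \<Longrightarrow> u \<in> jacobian_span \<Longrightarrow> (\<lambda>i. c * u i) \<in> jacobian_span" "(\<lambda>i. 0) \<in> jacobian_span"
    using M.M.a_closed[of u v] M.smult_closed[of c u] M.M.zero_closed
    by (simp_all add: jacobian_module_simps)
qed

lemma poly_diff_add: "poly_diff n (p + q) = (\<lambda>i. poly_diff n p i + poly_diff n q i)"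
  by (auto simp: poly_diff_def partial_deriv_add)

lemma poly_diff_mult: "poly_diff n (p * q) = (\<lambda>i. p * poly_diff n q i + q * poly_diff n p i)"
  by (auto simp: poly_diff_def partial_deriv_mult)

lemma poly_diff_constant: "c \<in> constants \<Longrightarrow> poly_diff n c = (\<lambda>i. 0)"
  by (auto simp: poly_diff_def partial_deriv_constant)

lemma poly_diff_in_jacobian_span:
  assumes "a \<in> S" shows "poly_diff n a \<in> jacobian_span"
proof -
  have "S \<subseteq> {a \<in> R. poly_diff n a \<in> jacobian_span}"
  proof (rule S_least)
    interpret K: subring_set "constants :: 'k mpol set" by (rule subring_set_constants)
    show "constants \<subseteq> {a \<in> R. poly_diff n a \<in> jacobian_span}"
      using constants_subset_mpol_set jacobian_span_closed(3) by (auto simp: poly_diff_constant)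
    show "subring_set {a \<in> R. poly_diff n a \<in> jacobian_span}"
    proof
      show "1 \<in> {a \<in> R. poly_diff n a \<in> jacobian_span}"
        using R.one_closed jacobian_span_closed(3) poly_diff_constant[OF K.one_closed] by simp
      fix a b assume ab: "a \<in> {a \<in> R. poly_diff n a \<in> jacobian_span}" "b \<in> {a \<in> R. poly_diff n a \<in> jacobian_span}"
      then show "a + b \<in> {a \<in> R. poly_diff n a \<in> jacobian_span}" "a * b \<in> {a \<in> R. poly_diff n a \<in> jacobian_span}"
        using jacobian_span_closed by (auto simp: poly_diff_add poly_diff_mult R.closed)
      have "- 1 \<in> R" by (intro R.closed)
      then show "- a \<in> {a \<in> R. poly_diff n a \<in> jacobian_span}"
        using ab jacobian_span_closed(2)[of "-1" "poly_diff n a"] poly_diff_constant[OF K.uminus_closed[OF K.one_closed]]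
          poly_diff_mult[of "-1" a] by (auto simp: R.closed K.closed)
    qed
    interpret M: module "ring_on R" "free_module (ring_on R) {..<n}" by (rule R.free_module_on_is_module)
    show "f j \<in> {a \<in> R. poly_diff n a \<in> jacobian_span}" if "j < m" for j
    proof -
      have "poly_diff n (f j) \<in> jacobian_span"
        unfolding jacobian_span_def by (rule subsetD[OF M.submodule_span_incl]) (use that in simp)
      with f[OF that] show ?thesis by simp
    qed
  qed
  with assms show ?thesis by blast
qed

text \<open>
  The map \<open>\<lambda>\<close> before passing to the quotient: the linear extension of \<open>a \<mapsto> da\<close>.
\<close>

definition dmap :: "('k mpol \<Rightarrow> 'k mpol) \<Rightarrow> nat \<Rightarrow> 'k mpol" where
  "dmap v = (\<lambda>i. linear_ext (\<lambda>a. poly_diff n a i) v)"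

lemma dmap_in_jacobian_span:
  assumes v: "v \<in> carrier F" shows "dmap v \<in> jacobian_span"
proof -
  have fin: "finite {a. v a \<noteq> 0}" using v by simp
  have "(\<lambda>i. \<Sum>a\<in>T. v a * poly_diff n a i) \<in> jacobian_span" if "finite T" "T \<subseteq> S" for T
    using that
  proof (induction T)
    case empty
    then show ?case using jacobian_span_closed(3) by simp
  next
    case (insert a T)
    have "v a \<in> R" using v insert.prems S_R by auto
    then show ?case
      using insert jacobian_span_closed(1)[OF jacobian_span_closed(2)[OF _ poly_diff_in_jacobian_span]] by simp
  qed
  moreover have "{a. v a \<noteq> 0} \<subseteq> S" using v by auto
  ultimately show ?thesis using fin by (simp add: dmap_def linear_ext_def)
qed

lemma dmap_linear: "dmap \<in> linear_maps (ring_on S) F (jacobian_module n m f)"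
proof -
  have "dmap (u \<oplus>\<^bsub>F\<^esub> v) = (\<lambda>i. dmap u i + dmap v i)" if "u \<in> carrier F" "v \<in> carrier F" for u v
    using that by (simp add: dmap_def linear_ext_add)
  moreover have "dmap (c \<odot>\<^bsub>F\<^esub> v) = (\<lambda>i. c * dmap v i)" if "v \<in> carrier F" for c v
    using that by (simp add: dmap_def linear_ext_smult)
  ultimately show ?thesis
    using dmap_in_jacobian_span by (simp add: linear_maps_def hom_def jacobian_module_simps Pi_def del: free_module_on_simps)
qed

lemma dmap_kernel:
  assumes "v \<in> N" shows "dmap v = (\<lambda>i. 0)"
  unfolding dmap_def
proof
  fix i
  show "linear_ext (\<lambda>a. poly_diff n a i) v = 0"
  proof (rule linear_ext_kernel[OF _ _ assms])
    show "derivation_on S (\<lambda>a. poly_diff n a i)"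
      by (simp add: derivation_on_def poly_diff_add poly_diff_mult)
  qed (simp add: poly_diff_constant)
qed

lemma dmap_generator_comb: "dmap (generator_comb m f v) = (\<lambda>i. \<Sum>j<m. v j * poly_diff n (f j) i)"
  by (simp add: dmap_def linear_ext_generator_comb)

lemma coefficient_closed: "v \<in> carrier (free_module (ring_on S) {..<m}) \<Longrightarrow> v j \<in> S"
  using zero_closed by (cases "j < m") auto

lemma forms_pi_eq:
  assumes v: "v \<in> carrier (free_module (ring_on S) {..<m})"
  shows "forms_pi n m f v = N +>\<^bsub>F\<^esub> generator_comb m f v"
proof -
  have fF: "unit_vec (f j) \<in> carrier F" if "j < m" for j
    using unit_vec_F[OF f_S[OF that]] .
  have t: "(\<lambda>x. v j * unit_vec (f j) x) \<in> carrier F" if "j < m" for j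
    using Q.smult_closed[of "v j", OF _ fF[OF that]] coefficient_closed[OF v] by (simp only: free_module_on_simps ring_on_simps)
  have "forms_pi n m f v = (\<Oplus>\<^bsub>quotient_module F N\<^esub>j\<in>{..<m}. N +>\<^bsub>F\<^esub> (\<lambda>x. v j * unit_vec (f j) x))"
    unfolding forms_pi_def forms_kaehler_eq
  proof (rule abelian_monoid.finsum_cong')
    show "abelian_monoid (quotient_module F N)"
      using Q.quotient_is_module by (simp add: module_def abelian_group_def)
    show "(\<lambda>j. N +>\<^bsub>F\<^esub> (\<lambda>x. v j * unit_vec (f j) x)) \<in> {..<m} \<rightarrow> carrier (quotient_module F N)"
      using t by (auto simp: Q.quotient_simps simp del: free_module_on_simps)
    fix j assume "j \<in> {..<m}"
    then show "v j \<odot>\<^bsub>quotient_module F N\<^esub> kaehler_d constants (forms_algebra n m f) (f j)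
        = N +>\<^bsub>F\<^esub> (\<lambda>x. v j * unit_vec (f j) x)"
      using Q.quotient_smult[of "v j" "unit_vec (f j)"] coefficient_closed[OF v] fF
      by (simp add: kaehler_d_def forms_algebra_eq basis_vec_unit_vec)
  qed simp
  also have "\<dots> = N +>\<^bsub>F\<^esub> (\<Oplus>\<^bsub>F\<^esub>j\<in>{..<m}. (\<lambda>x. v j * unit_vec (f j) x))"
    using t by (intro Q.quotient_finsum) auto
  also have "(\<Oplus>\<^bsub>F\<^esub>j\<in>{..<m}. (\<lambda>x. v j * unit_vec (f j) x)) = generator_comb m f v"
    unfolding generator_comb_def using t Q.M.abelian_monoid_axioms by (intro pointwise_finsum) auto
  finally show ?thesis .
qed

lemma jacobian_map_eq:
  assumes v: "v \<in> carrier (free_module (ring_on R) {..<m})"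
  shows "jacobian_map n m f v = (\<lambda>i. \<Sum>j<m. v j * poly_diff n (f j) i)"
proof -
  interpret M: module "ring_on R" "jacobian_module n m f" by (rule jacobian_module)
  show ?thesis
    unfolding jacobian_map_def jacobian_module_simps(4)
  proof (rule pointwise_finsum[OF M.abelian_monoid_axioms])
    fix j assume "j \<in> {..<m}"
    then show "(\<lambda>i. v j * poly_diff n (f j) i) \<in> carrier (jacobian_module n m f)"
      using v jacobian_span_closed(2)[OF _ poly_diff_in_jacobian_span[OF f_S]] by (simp add: jacobian_module_simps)
  qed (simp_all add: jacobian_module_simps)
qed

text \<open>
  From left to right the scalar can be cancelled, as the target is contained in a free module over a
  domain. From right to left, a non-torsion element would be detected by a derivation of the
  subalgebra, which vanishes on it by \<open>derivation_vanishes_on_jacobian_syzygy\<close>.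
\<close>

lemma torsion_iff_dmap_zero:
  assumes v: "v \<in> carrier (free_module (ring_on S) {..<m})"
  shows "(\<exists>c\<in>S. c \<noteq> 0 \<and> (\<lambda>x. c * generator_comb m f v x) \<in> N) \<longleftrightarrow> dmap (generator_comb m f v) = (\<lambda>i. 0)"
proof
  assume "\<exists>c\<in>S. c \<noteq> 0 \<and> (\<lambda>x. c * generator_comb m f v x) \<in> N"
  then obtain c where c: "c \<noteq> 0" "(\<lambda>x. c * generator_comb m f v x) \<in> N" by blast
  have "(\<lambda>i. c * dmap (generator_comb m f v) i) = (\<lambda>i. 0)"
    using dmap_kernel[OF c(2)] by (simp add: dmap_def linear_ext_smult finite_generator_comb)
  then show "dmap (generator_comb m f v) = (\<lambda>i. 0)"
    using c(1) by (simp add: fun_eq_iff)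
next
  assume 0: "dmap (generator_comb m f v) = (\<lambda>i. 0)"
  show "\<exists>c\<in>S. c \<noteq> 0 \<and> (\<lambda>x. c * generator_comb m f v x) \<in> N"
  proof (rule ccontr)
    assume nt: "\<not> ?thesis"
    have "\<exists>D. derivation_on S D \<and> (\<forall>c\<in>constants. D c = 0) \<and> (\<Sum>j<m. v j * D (f j)) \<noteq> 0"
    proof (rule nontorsion_derivation)
      show "v j = 0" if "j \<ge> m" for j using v that by simp
      show "(\<lambda>x. c * generator_comb m f v x) \<notin> N" if "c \<in> S" "c \<noteq> 0" for c using nt that by blast
    qed (fact f_S | rule coefficient_closed[OF v] | rule S_least; assumption)+
    then obtain D where D: "derivation_on S D" "\<And>c. c \<in> constants \<Longrightarrow> D c = 0"
      and nz: "(\<Sum>j<m. v j * D (f j)) \<noteq> 0"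
      by blast
    have jac: "(\<Sum>j<m. v j * partial_deriv i (f j)) = 0" if "i < n" for i
      using fun_cong[OF 0, of i] that by (simp add: dmap_generator_comb poly_diff_def)
    have "(\<Sum>j<m. v j * D (f j)) = 0"
      by (rule derivation_vanishes_on_jacobian_syzygy[OF subring_S constants_S D f_S f jac])
    with nz show False ..
  qed
qed

lemma free_module_algebra_subset:
  "carrier (free_module (forms_algebra n m f) {..<m}) \<subseteq> carrier (free_module (mpol_ring n) {..<m})"
  using S_R by (auto simp: forms_algebra_eq mpol_ring_eq)

lemma dmap_eq_jacobian_map:
  assumes v: "v \<in> carrier (free_module (ring_on S) {..<m})"
  shows "dmap (generator_comb m f v) = jacobian_map n m f v"
proof -
  have "v \<in> carrier (free_module (ring_on R) {..<m})" using v S_R by auto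
  then show ?thesis by (simp add: dmap_generator_comb jacobian_map_eq)
qed

lemma generator_comb_family_F: "v \<in> carrier (free_module (ring_on S) {..<m}) \<Longrightarrow> generator_comb m f v \<in> carrier F"
  by (rule generator_comb_F[OF f_S coefficient_closed])

lemma kaehler_to_jacobian_exists:
  "\<exists>l\<in>linear_maps (forms_algebra n m f) (forms_kaehler n m f) (jacobian_module n m f).
    \<forall>v\<in>carrier (free_module (forms_algebra n m f) {..<m}).
      forms_pi n m f v \<in> carrier (forms_kaehler n m f) \<and> l (forms_pi n m f v) = jacobian_map n m f v"
proof -
  interpret P: module "ring_on R" "jacobian_module n m f" by (rule jacobian_module)
  obtain l where l: "l \<in> linear_maps (ring_on S) (quotient_module F N) (jacobian_module n m f)"
    and lx: "\<And>x. x \<in> carrier F \<Longrightarrow> l (N +>\<^bsub>F\<^esub> x) = dmap x"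
    using Q.linear_map_factors_through_quotient[OF dmap_linear P.abelian_group_axioms] dmap_kernel
    by (auto simp: jacobian_module_simps simp del: free_module_on_simps)
  show ?thesis
    unfolding forms_algebra_eq forms_kaehler_eq
    by (rule bexI[OF _ l])
      (auto simp: forms_pi_eq lx generator_comb_family_F dmap_eq_jacobian_map Q.quotient_simps
        simp del: free_module_on_simps)
qed

lemma forms_pi_torsion_iff:
  assumes "v \<in> carrier (free_module (forms_algebra n m f) {..<m})"
  shows "forms_pi n m f v \<in> torsion (forms_algebra n m f) (forms_kaehler n m f)
    \<longleftrightarrow> jacobian_map n m f v = \<zero>\<^bsub>jacobian_module n m f\<^esub>"
proof -
  have v: "v \<in> carrier (free_module (ring_on S) {..<m})"
    using assms by (simp only: forms_algebra_eq)
  note cF = generator_comb_family_F[OF v]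
  have "c \<odot>\<^bsub>quotient_module F N\<^esub> (N +>\<^bsub>F\<^esub> generator_comb m f v) = \<zero>\<^bsub>quotient_module F N\<^esub>
      \<longleftrightarrow> (\<lambda>x. c * generator_comb m f v x) \<in> N" if "c \<in> S" for c
  proof -
    have "c \<odot>\<^bsub>F\<^esub> generator_comb m f v \<in> carrier F"
      using Q.smult_closed[OF _ cF] that by simp
    then show ?thesis
      using Q.quotient_smult[OF _ cF, of c] Q.coset_eq_zero_iff[of "c \<odot>\<^bsub>F\<^esub> generator_comb m f v"] that
      by (simp add: Q.quotient_simps(2))
  qed
  then have "forms_pi n m f v \<in> torsion (ring_on S) (quotient_module F N)
      \<longleftrightarrow> dmap (generator_comb m f v) = (\<lambda>i. 0)"
    using torsion_iff_dmap_zero[OF v] cF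
    by (auto simp: torsion_def forms_pi_eq[OF v] Q.quotient_simps(1) simp del: free_module_on_simps)
  then show ?thesis
    by (simp only: forms_algebra_eq forms_kaehler_eq dmap_eq_jacobian_map[OF v] jacobian_module_simps)
qed

end

theorem theorem2p1:
  fixes n m :: nat and f :: "nat \<Rightarrow> 'k::field_char_0 mpol"
  assumes "\<And>j. j < m \<Longrightarrow> f j \<in> carrier (mpol_ring n)"
    and "\<And>j. j < m \<Longrightarrow> is_form (f j)"
  shows "\<exists>l \<in> linear_maps (forms_algebra n m f) (forms_kaehler n m f) (jacobian_module n m f).
      pi_preimage n m f (a_kernel (forms_kaehler n m f) (jacobian_module n m f) l)
        = pi_preimage n m f (torsion (forms_algebra n m f) (forms_kaehler n m f)) \<and>
      pi_preimage n m f (torsion (forms_algebra n m f) (forms_kaehler n m f))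
        = jacobian_syz n m f \<inter> carrier (free_module (forms_algebra n m f) {..<m})"
proof -
  interpret polynomial_family n m f
    by unfold_locales (use assms(1) in \<open>simp add: mpol_ring_eq\<close>)
  obtain l where l: "l \<in> linear_maps (forms_algebra n m f) (forms_kaehler n m f) (jacobian_module n m f)"
    and lv: "\<And>v. v \<in> carrier (free_module (forms_algebra n m f) {..<m}) \<Longrightarrow>
      forms_pi n m f v \<in> carrier (forms_kaehler n m f) \<and> l (forms_pi n m f v) = jacobian_map n m f v"
    using kaehler_to_jacobian_exists by blast
  have kernel: "pi_preimage n m f (a_kernel (forms_kaehler n m f) (jacobian_module n m f) l)
      = {v \<in> carrier (free_module (forms_algebra n m f) {..<m}).
          jacobian_map n m f v = \<zero>\<^bsub>jacobian_module n m f\<^esub>}"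
    unfolding pi_preimage_def a_kernel_def' using lv by auto
  have torsion: "pi_preimage n m f (torsion (forms_algebra n m f) (forms_kaehler n m f))
      = {v \<in> carrier (free_module (forms_algebra n m f) {..<m}).
          jacobian_map n m f v = \<zero>\<^bsub>jacobian_module n m f\<^esub>}"
    unfolding pi_preimage_def using forms_pi_torsion_iff by blast
  have syz: "jacobian_syz n m f \<inter> carrier (free_module (forms_algebra n m f) {..<m})
      = {v \<in> carrier (free_module (forms_algebra n m f) {..<m}).
          jacobian_map n m f v = \<zero>\<^bsub>jacobian_module n m f\<^esub>}"
    unfolding jacobian_syz_def a_kernel_def' using free_module_algebra_subset by blast
  show ?thesis using l kernel torsion syz by blast
qed

end
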